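(* Assume the hypotheses (a)–(d) of the setting below, and in addition: (e) $\Theta$ is finite; (f) for all $\theta_1<\theta_2$ in $\Theta$, $$\inf_{\theta>\theta_2}\sup_{x\in\mathbf X} I(\theta_1,\theta\mid x)=\sup_{x\in\mathbf X}\inf_{\theta>\theta_2} I(\theta_1,\theta\mid x),$$ and symmetrically with the roles of $\theta_1,\theta_2$ exchanged. Then there exists a uniformly good allocation rule $\{\phi_\tau\}$ such that for every $C_0=(\theta_1,\theta_2)\in\Theta^2$ with $\theta_1\ne\theta_2$, $$\limsup_{t\to\infty}\frac{\mathsf E_{C_0}\{T_{inf}(t)\}}{\log t}\le\frac1{K_{C_0}},$$ where $K_{C_0}=\inf_{\theta>\theta_2}\sup_x I(\theta_1,\theta\mid x)$ if $\theta_1<\theta_2$ and $K_{C_0}=\inf_{\theta>\theta_1}\sup_x I(\theta_2,\theta\mid x)$ if $\theta_1>\theta_2$; i.e. this rule attains the lower bound of the preceding lower-bound theorem and is asymptotically optimal.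
   Context: Two-armed bandit with side observations. $\Theta\subset\mathbb R$ is a parameter set and $\mathbf X\subset\mathbb R$. Known conditional distributions $\{F_\theta(dy\mid x)\}_{\theta\in\Theta}$ on $\mathbb R$ and a known law $G$ on $\mathbf X$. Under configuration $C_0=(\theta_1,\theta_2)\in\Theta^2$, $X_1,X_2,\dots$ are i.i.d. with law $G$, and for each arm $i$ the pairs $(X_t,Y^i_t)$ are i.i.d. with joint law $G(dx)F_{\theta_i}(dy\mid x)$. An allocation rule is $\phi_t\in\{1,2\}$ depending only on $X_1,\dots,X_t$ and previously observed rewards $Y^{\phi_\tau}_\tau$, $\tau<t$. Standing hypotheses: (a) $G$ does not depend on the configuration; (b) $\mathbf X$ is finite and $\mathsf P_G(X_t=x)>0$ for all $x$; (c) $0<I(\theta,\vartheta\mid x)<\infty$ for all $\theta\ne\vartheta$ and all $x$; (d) for every $x$, $\theta\mapsto\mu_\theta(x)=\int yF_\theta(dy\mid x)$ is strictly increasing. $M_C(x)=\arg\max_i\mu_{i(C)}(x)$ with $1(C)=\theta_1,2(C)=\theta_2$; $T_{inf}(t)=\sum_{\tau\le t}1\{\phi_\tau\ne M_{C_0}(X_\tau)\}$. $I(\theta,\vartheta\mid x)$ is the Kullback–Leibler number between $F_\theta(\cdot\mid x)$ and $F_\vartheta(\cdot\mid x)$. A rule is uniformly good if for all $C$ and all $\alpha>0$, $\mathsf E_C\{T_{inf}(t)\}=o(t^\alpha)$. Conventions: $\inf\emptyset=\infty$, $1/\infty=0$. *)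

theory Defs
  imports "HOL-Probability.Probability" "HOL-Library.Landau_Symbols"
begin

text \<open>Kullback--Leibler number D(P || Q) = integral of ln(dP/dQ) w.r.t. P (natural logarithm).
  KL_divergence b M N is D(N || M) in the library.\<close>
definition KLnum :: "'a measure \<Rightarrow> 'a measure \<Rightarrow> real" where
  "KLnum P Q = KL_divergence (exp 1) Q P"

definition KL_finite :: "'a measure \<Rightarrow> 'a measure \<Rightarrow> bool" where
  "KL_finite P Q \<longleftrightarrow> absolutely_continuous Q P \<and> integrable P (entropy_density (exp 1) Q P)"

definition mean :: "(real \<Rightarrow> real \<Rightarrow> real measure) \<Rightarrow> real \<Rightarrow> real \<Rightarrow> real" where
  "mean F \<theta> x = (\<integral>y. y \<partial>(F \<theta> x))"

definition par :: "real \<times> real \<Rightarrow> nat \<Rightarrow> real" where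
  "par C i = (if i = 1 then fst C else snd C)"

definition best :: "(real \<Rightarrow> real \<Rightarrow> real measure) \<Rightarrow> real \<times> real \<Rightarrow> real \<Rightarrow> nat set" where
  "best F C x = {i \<in> {1,2}. \<forall>j\<in>{1,2}. mean F (par C j) x \<le> mean F (par C i) x}"

text \<open>Allocation rule: phi t xs ys is the arm chosen at time t (t >= 1), where xs is the
  sequence of covariates (only xs 1..xs t may be used) and ys the sequence of observed rewards
  (only ys 1 .. ys (t-1) may be used).  The rule is required to be measurable.\<close>
definition alloc_rule :: "(nat \<Rightarrow> (nat \<Rightarrow> real) \<Rightarrow> (nat \<Rightarrow> real) \<Rightarrow> nat) \<Rightarrow> bool" where
  "alloc_rule \<phi> \<longleftrightarrow>
     (\<forall>t xs ys. \<phi> t xs ys \<in> {1,2}) \<and>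
     (\<forall>t xs ys xs' ys'. (\<forall>\<tau>\<in>{1..t}. xs \<tau> = xs' \<tau>) \<and> (\<forall>\<tau>\<in>{1..<t}. ys \<tau> = ys' \<tau>)
         \<longrightarrow> \<phi> t xs ys = \<phi> t xs' ys') \<and>
     (\<forall>t. (\<lambda>(xs, ys). \<phi> t xs ys) \<in>
          measurable (pair_measure (PiM UNIV (\<lambda>_. borel)) (PiM UNIV (\<lambda>_. borel))) (count_space UNIV))"

text \<open>Canonical sample space under configuration C: at each time t one draws
  X_t ~ G and, independently, for every x in the covariate set, a reward Z^i_t(x) ~ F_{theta_i}(.|x)
  for each arm i; the reward of arm i at time t is Y^i_t = Z^i_t(X_t).  Everything is
  independent across t, so (X_t, Y^i_t) are i.i.d. with law G(dx) F_{theta_i}(dy|x).\<close>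
definition sspace :: "(real \<Rightarrow> real \<Rightarrow> real measure) \<Rightarrow> real pmf \<Rightarrow> real \<times> real
      \<Rightarrow> (nat \<Rightarrow> real \<times> (real \<Rightarrow> real) \<times> (real \<Rightarrow> real)) measure" where
  "sspace F G C = PiM UNIV (\<lambda>t. pair_measure (measure_pmf G)
      (pair_measure (PiM (set_pmf G) (\<lambda>x. F (fst C) x)) (PiM (set_pmf G) (\<lambda>x. F (snd C) x))))"

definition Xs :: "(nat \<Rightarrow> real \<times> (real \<Rightarrow> real) \<times> (real \<Rightarrow> real)) \<Rightarrow> nat \<Rightarrow> real" where
  "Xs \<omega> t = fst (\<omega> t)"

definition rew :: "(nat \<Rightarrow> real \<times> (real \<Rightarrow> real) \<times> (real \<Rightarrow> real)) \<Rightarrow> nat \<Rightarrow> nat \<Rightarrow> real" where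
  "rew \<omega> i t = (if i = 1 then fst (snd (\<omega> t)) else snd (snd (\<omega> t))) (Xs \<omega> t)"

fun hist :: "(nat \<Rightarrow> (nat \<Rightarrow> real) \<Rightarrow> (nat \<Rightarrow> real) \<Rightarrow> nat)
      \<Rightarrow> (nat \<Rightarrow> real \<times> (real \<Rightarrow> real) \<times> (real \<Rightarrow> real)) \<Rightarrow> nat \<Rightarrow> nat \<Rightarrow> real" where
  "hist \<phi> \<omega> 0 = (\<lambda>_. 0)"
| "hist \<phi> \<omega> (Suc n) =
     (hist \<phi> \<omega> n)(Suc n := rew \<omega> (\<phi> (Suc n) (Xs \<omega>) (hist \<phi> \<omega> n)) (Suc n))"

definition arm :: "(nat \<Rightarrow> (nat \<Rightarrow> real) \<Rightarrow> (nat \<Rightarrow> real) \<Rightarrow> nat)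
      \<Rightarrow> (nat \<Rightarrow> real \<times> (real \<Rightarrow> real) \<times> (real \<Rightarrow> real)) \<Rightarrow> nat \<Rightarrow> nat" where
  "arm \<phi> \<omega> t = \<phi> t (Xs \<omega>) (hist \<phi> \<omega> (t - 1))"

definition Tinf where
  "Tinf F \<phi> C \<omega> t = card {\<tau> \<in> {1..t}. arm \<phi> \<omega> \<tau> \<notin> best F C (Xs \<omega> \<tau>)}"

definition ETinf where
  "ETinf F G \<phi> C t = (\<integral>\<omega>. real (Tinf F \<phi> C \<omega> t) \<partial>(sspace F G C))"

definition uniformly_good where
  "uniformly_good F G \<Theta> \<phi> \<longleftrightarrow>
     (\<forall>C \<in> \<Theta> \<times> \<Theta>. \<forall>\<alpha>>0. (\<lambda>t. ETinf F G \<phi> C t) \<in> o(\<lambda>t. real t powr \<alpha>))"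

text \<open>K_{C_0} (extended real; inf over the empty set is +infinity)\<close>
definition Kc :: "(real \<Rightarrow> real \<Rightarrow> real measure) \<Rightarrow> real pmf \<Rightarrow> real set \<Rightarrow> real \<times> real \<Rightarrow> ereal" where
  "Kc F G \<Theta> C = (if fst C < snd C
     then (INF \<theta>\<in>{\<theta>\<in>\<Theta>. snd C < \<theta>}. SUP x\<in>set_pmf G. ereal (KLnum (F (fst C) x) (F \<theta> x)))
     else (INF \<theta>\<in>{\<theta>\<in>\<Theta>. fst C < \<theta>}. SUP x\<in>set_pmf G. ereal (KLnum (F (snd C) x) (F \<theta> x))))"

end

theory Submission
  imports Defs "HOL-Real_Asymp.Real_Asymp"
begin

text \<open>By strict monotonicity of the means, the superior arm does not depend on the covariate, so
  \<open>Tinf\<close> counts the pulls of the arm with the smaller parameter. The rule plays the arm whose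
  maximum likelihood estimate is larger, and explores the other one only at the covariate \<open>xst a b\<close>
  that maximises the worst-case Kullback--Leibler number for the current estimates \<open>a < b\<close>, only if
  that arm has been pulled less often, and only until every parameter above \<open>b\<close> is rejected for it
  by a likelihood ratio test of level about \<open>1/t\<close>; without a strict leader it plays the less
  sampled arm. Hypothesis (f) makes each exploratory pull worth at least \<open>K\<close> nats against every
  parameter above \<open>b\<close>, which gives \<open>log t / K\<close> such pulls while both estimates are correct.

  All other pulls of the inferior arm have bounded expected number. All the probabilities needed
  come from one maximal inequality for products of conditionally normalised factors: after \<open>n\<close> pulls
  an estimate is wrong with probability exponentially small in \<open>n\<close>, and a true parameter is rejected
  at time \<open>t\<close> with summable probability. If the superior arm is underestimated, not rejected and
  less sampled, an independent covariate \<open>xst a b\<close> leads to a pull of it with a wrong estimate, so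
  this can happen only finitely often in the mean.\<close>

section \<open>Log-likelihood ratios\<close>

text \<open>Finite Kullback-Leibler numbers give no moment of a log-likelihood ratio
  \<open>L\<close> beyond its mean. The substitute is that \<open>exp (- L)\<close> has mean one:
  \<open>exp (- s * L)\<close> is then integrable for 0 < s \<le> 1, and its mean has slope minus
  the Kullback-Leibler number at s = 0. This yields exponential bounds at every rate below that
  number. Sampling is adaptive, so deviations are indexed by the number of pulls instead of time; a
  maximal inequality covers all rounds with the same count at once. The comparison of pull counts in
  the rule serves this bookkeeping: while the inferior arm is not ahead, its count is at most the
  count m of the superior arm, so each m accounts for at most m + 1 of its pulls. The remaining
  danger is a superior arm with few, unlucky pulls: trusting the estimates would produce no further
  data on it. The test forces its exploration, because its true parameter lies above the parameter
  of the apparent leader and hence is among those to be rejected. Without (f), different competing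
  parameters could call for different covariates; with it, one maximin covariate serves against all
  of them.\<close>

lemma nn_integral_exp_entropy_density:
  fixes P Q :: "'a measure"
  assumes P: "prob_space P" and Q: "prob_space Q" and sets: "sets P = sets Q"
    and PQ: "absolutely_continuous Q P" and QP: "absolutely_continuous P Q"
    and g[measurable]: "g \<in> borel_measurable Q"
  shows "(\<integral>\<^sup>+y. g y * ennreal (exp (entropy_density (exp 1) Q P y)) \<partial>Q) = (\<integral>\<^sup>+y. g y \<partial>P)"
proof -
  interpret P: prob_space P by fact
  interpret Q: prob_space Q by fact
  have dens: "density Q (RN_deriv Q P) = P"
    using PQ sets by (intro Q.density_RN_deriv)
  have fin: "AE y in Q. RN_deriv Q P y \<noteq> \<infinity>"
    using PQ sets P.sigma_finite_measure_axioms by (intro Q.RN_deriv_finite)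
  \<comment> \<open>Exponentiating the logarithm recovers the density only where it is positive and
    finite. Positivity is automatic P-almost everywhere; \<open>QP\<close> carries it over to Q,
    where the integral lives.\<close>
  have "AE y in P. RN_deriv Q P y \<noteq> 0"
    by (subst dens[symmetric], subst AE_density) auto
  then have pos: "AE y in Q. RN_deriv Q P y \<noteq> 0"
    using QP sets by (intro absolutely_continuous_AE[of Q P]) auto
  have "(\<integral>\<^sup>+y. g y * ennreal (exp (entropy_density (exp 1) Q P y)) \<partial>Q)
      = (\<integral>\<^sup>+y. RN_deriv Q P y * g y \<partial>Q)"
  proof (rule nn_integral_cong_AE, use fin pos in eventually_elim)
    case (elim y)
    then have "ennreal (enn2real (RN_deriv Q P y)) = RN_deriv Q P y" "0 < enn2real (RN_deriv Q P y)"
      by (auto simp: enn2real_positive_iff less_top zero_less_iff_neq_zero)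
    then show ?case
      by (simp add: entropy_density_def log_def mult.commute)
  qed
  also have "\<dots> = (\<integral>\<^sup>+y. g y \<partial>density Q (RN_deriv Q P))"
    by (intro nn_integral_density[symmetric]) auto
  finally show ?thesis
    by (simp add: dens)
qed

text \<open>A majorant of the difference quotients at 0 that is free of s, as dominated convergence
  for s tending to 0 requires. For z \<ge> 0 the tangent line of exp bounds the quotient by z; for z
  < 0 convexity bounds it by the chord over the unit interval.\<close>

lemma abs_exp_minus_one_divide_le:
  fixes z s :: real
  assumes "0 < s" "s \<le> 1"
  shows "\<bar>(exp (- s * z) - 1) / s\<bar> \<le> \<bar>z\<bar> + exp (- z)"
proof (cases "0 \<le> z")
  case True
  have "1 - s * z \<le> exp (- s * z)"
    using exp_ge_add_one_self[of "- s * z"] by simp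
  moreover have "exp (- s * z) \<le> 1"
    using True assms by simp
  ultimately have "\<bar>exp (- s * z) - 1\<bar> \<le> s * z" by simp
  then have "\<bar>exp (- s * z) - 1\<bar> / s \<le> z"
    using assms by (simp add: divide_le_eq mult.commute)
  moreover have "0 < exp (- z)" by simp
  ultimately show ?thesis
    using True assms unfolding abs_divide by (simp del: exp_gt_zero)
next
  case False
  have "exp ((1 - s) *\<^sub>R 0 + s *\<^sub>R (- z)) \<le> (1 - s) * exp 0 + s * exp (- z)"
    using assms by (intro convex_onD[OF exp_convex]) auto
  then have "exp (- s * z) - 1 \<le> s * (exp (- z) - 1)"
    by (simp add: algebra_simps)
  also have "\<dots> \<le> s * exp (- z)"
    using assms by (intro mult_left_mono) auto
  finally have "(exp (- s * z) - 1) / s \<le> exp (- z)"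
    using assms by (simp add: divide_le_eq mult.commute)
  moreover have "0 \<le> (exp (- s * z) - 1) / s"
    using False assms by (intro divide_nonneg_pos) (auto simp: mult_nonneg_nonpos)
  ultimately show ?thesis by linarith
qed

text \<open>The mean of \<open>exp (- s * (L - \<kappa>))\<close> equals 1 at s = 0 and has right
  derivative \<kappa> minus the mean of L there, which is negative. Stating this for all large n,
  with s = 1/(n+1), lets finitely many covariates share one exponent later.\<close>

lemma eventually_nn_integral_exp_le_1:
  fixes P :: "'a measure" and L :: "'a \<Rightarrow> real"
  assumes P: "prob_space P" and int: "integrable P L"
    and bnd: "(\<integral>\<^sup>+y. ennreal (exp (- L y)) \<partial>P) \<le> 1" and kap: "\<kappa> < (\<integral>y. L y \<partial>P)"
  shows "\<forall>\<^sub>F n in sequentially.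
    (\<integral>\<^sup>+y. ennreal (exp (- inverse (real (Suc n)) * (L y - \<kappa>))) \<partial>P) \<le> 1"
proof -
  interpret P: prob_space P by fact
  have [measurable]: "L \<in> borel_measurable P" using int by auto
  define s where "s n = inverse (real (Suc n))" for n
  have s: "0 < s n" "s n \<le> 1" for n
    by (auto simp: s_def field_simps)
  have s0: "s \<longlonglongrightarrow> 0"
    unfolding s_def by (rule LIMSEQ_inverse_real_of_nat)
  have intexp: "integrable P (\<lambda>y. exp (- L y))"
    using bnd by (intro integrableI_bounded) (auto simp: less_top[symmetric] top_unique)
  have dom: "AE y in P. norm ((exp (- s n * L y) - 1) / s n) \<le> \<bar>L y\<bar> + exp (- L y)" for n
    using abs_exp_minus_one_divide_le[OF s] by simp
  have ints: "integrable P (\<lambda>y. (exp (- s n * L y) - 1) / s n)" for n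
    by (rule Bochner_Integration.integrable_bound[of _ "\<lambda>y. \<bar>L y\<bar> + exp (- L y)"])
       (use dom[of n] int intexp in auto)
  have lim: "(\<lambda>n. (exp (- s n * z) - 1) / s n) \<longlonglongrightarrow> - z" for z
  proof -
    have "((\<lambda>u. exp (- u * z)) has_field_derivative - z) (at 0)"
      by (auto intro!: derivative_eq_intros)
    then have "((\<lambda>u. (exp (- u * z) - 1) / u) \<longlongrightarrow> - z) (at 0)"
      by (simp add: DERIV_def)
    moreover have "filterlim s (at 0) sequentially"
      using s0 s by (auto simp: filterlim_at intro!: always_eventually) (metis less_irrefl)
    ultimately show ?thesis
      by (rule filterlim_compose)
  qed
  have "(\<lambda>n. \<integral>y. (exp (- s n * L y) - 1) / s n \<partial>P) \<longlonglongrightarrow> (\<integral>y. - L y \<partial>P)"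
    by (rule integral_dominated_convergence[where w="\<lambda>y. \<bar>L y\<bar> + exp (- L y)"])
       (use int intexp lim dom in auto)
  \<comment> \<open>A difference quotient below -\<kappa> means that the mean of
    \<open>exp (- s n * L y)\<close> is below 1 - s \<kappa>, hence at most
    \<open>exp (- s n * \<kappa>)\<close>; multiplying by \<open>exp (s n * \<kappa>)\<close> gives
    the normalisation.\<close>
  then have "\<forall>\<^sub>F n in sequentially. (\<integral>y. (exp (- s n * L y) - 1) / s n \<partial>P) < - \<kappa>"
    using kap by (auto intro: order_tendstoD)
  then show ?thesis
  proof eventually_elim
    case (elim n)
    have i1: "integrable P (\<lambda>y. exp (- s n * L y))"
    proof -
      have "integrable P (\<lambda>y. s n * ((exp (- s n * L y) - 1) / s n) + 1)"
        by (intro Bochner_Integration.integrable_add integrable_mult_right ints) auto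
      then show ?thesis using s[of n] by simp
    qed
    have "(\<integral>y. (exp (- s n * L y) - 1) / s n \<partial>P) = ((\<integral>y. exp (- s n * L y) \<partial>P) - 1) / s n"
      using i1 by (simp add: Bochner_Integration.integral_diff P.prob_space)
    with elim have "(\<integral>y. exp (- s n * L y) \<partial>P) \<le> 1 + - s n * \<kappa>"
      using s[of n] by (simp add: divide_less_eq algebra_simps)
    also have "\<dots> \<le> exp (- s n * \<kappa>)"
      by (rule exp_ge_add_one_self)
    finally have "exp (s n * \<kappa>) * (\<integral>y. exp (- s n * L y) \<partial>P) \<le> exp (s n * \<kappa>) * exp (- s n * \<kappa>)"
      by (intro mult_left_mono) auto
    then have le1: "exp (s n * \<kappa>) * (\<integral>y. exp (- s n * L y) \<partial>P) \<le> 1"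
      by (simp add: exp_add[symmetric])
    have "(\<integral>\<^sup>+y. ennreal (exp (- s n * (L y - \<kappa>))) \<partial>P)
        = (\<integral>\<^sup>+y. ennreal (exp (s n * \<kappa>) * exp (- s n * L y)) \<partial>P)"
      by (simp add: exp_add[symmetric] algebra_simps)
    also have "\<dots> = ennreal (\<integral>y. exp (s n * \<kappa>) * exp (- s n * L y) \<partial>P)"
      using i1 by (intro nn_integral_eq_integral) auto
    also have "\<dots> = ennreal (exp (s n * \<kappa>) * (\<integral>y. exp (- s n * L y) \<partial>P))"
      by simp
    also have "\<dots> \<le> 1"
      using le1 by simp
    finally show ?case
      by (simp only: s_def)
  qed
qed

section \<open>Resampling a coordinate and Ville's inequality\<close>

text \<open>Redrawing one coordinate independently leaves a product law unchanged. When the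
  remaining factors ignore coordinate n, the inner integral plays the part of a conditional
  expectation, so no filtration has to be set up.\<close>

lemma nn_integral_PiM_resample:
  fixes M :: "'a measure" and n :: nat
  assumes M: "prob_space M" and f[measurable]: "f \<in> borel_measurable (PiM UNIV (\<lambda>_::nat. M))"
  shows "(\<integral>\<^sup>+w. f w \<partial>PiM UNIV (\<lambda>_. M)) = (\<integral>\<^sup>+w. (\<integral>\<^sup>+z. f (w(n := z)) \<partial>M) \<partial>PiM UNIV (\<lambda>_. M))"
proof -
  interpret M: prob_space M by fact
  interpret O: prob_space "PiM UNIV (\<lambda>_::nat. M)"
    using M by (intro prob_space_PiM)
  interpret MO: pair_sigma_finite M "PiM UNIV (\<lambda>_::nat. M)" ..
  have eq: "distr (M \<Otimes>\<^sub>M PiM UNIV (\<lambda>_. M)) (PiM UNIV (\<lambda>_. M)) (\<lambda>(z, w). w(n := z)) = PiM UNIV (\<lambda>_. M)"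
    using distr_pair_PiM_eq_PiM[of UNIV "\<lambda>_. M" n] M by simp
  have [measurable]: "(\<lambda>(z, w). w(n := z)) \<in> M \<Otimes>\<^sub>M PiM UNIV (\<lambda>_. M) \<rightarrow>\<^sub>M PiM UNIV (\<lambda>_. M)"
    unfolding split_beta' by (rule measurable_fun_upd[where J=UNIV]) auto
  have "(\<integral>\<^sup>+w. f w \<partial>PiM UNIV (\<lambda>_. M))
      = (\<integral>\<^sup>+p. f ((\<lambda>(z, w). w(n := z)) p) \<partial>(M \<Otimes>\<^sub>M PiM UNIV (\<lambda>_. M)))"
    by (subst eq[symmetric], subst nn_integral_distr) auto
  also have "\<dots> = (\<integral>\<^sup>+w. (\<integral>\<^sup>+z. f (w(n := z)) \<partial>M) \<partial>PiM UNIV (\<lambda>_. M))"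
    by (subst MO.nn_integral_snd[symmetric]) auto
  finally show ?thesis .
qed

text \<open>Ville's maximal inequality for a product of factors \<open>exp (q n)\<close> with conditional mean at
  most one: the product stopped when its logarithm reaches \<open>c\<close> still has mean at most one.
  Conditioning on the past is integration over the \<open>n\<close>-th coordinate.\<close>
lemma prob_ex_sum_ge_le_exp:
  fixes M :: "'a measure" and q :: "nat \<Rightarrow> (nat \<Rightarrow> 'a) \<Rightarrow> real"
  assumes M: "prob_space M"
    and q[measurable]: "\<And>n. q n \<in> borel_measurable (PiM UNIV (\<lambda>_::nat. M))"
    and past: "\<And>m n w z. m < n \<Longrightarrow> q m (w(n := z)) = q m w"
    and step: "\<And>n w. 1 \<le> n \<Longrightarrow> w \<in> space (PiM UNIV (\<lambda>_. M)) \<Longrightarrow>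
      (\<integral>\<^sup>+z. ennreal (exp (q n (w(n := z)))) \<partial>M) \<le> 1"
  shows "measure (PiM UNIV (\<lambda>_. M)) {w\<in>space (PiM UNIV (\<lambda>_. M)). \<exists>n. c \<le> (\<Sum>s\<in>{1..n}. q s w)} \<le> exp (- c)"
proof -
  let ?O = "PiM UNIV (\<lambda>_::nat. M)"
  interpret M: prob_space M by fact
  interpret O: prob_space ?O
    using M by (intro prob_space_PiM)
  define stop where "stop n w \<longleftrightarrow> (\<exists>m\<in>{..n}. c \<le> (\<Sum>s\<in>{1..m}. q s w))" for n w
  have [measurable]: "Measurable.pred ?O (stop n)" for n
    unfolding stop_def by measurable
  \<comment> \<open>Factor k is frozen by \<open>stop (k - 1)\<close>, not \<open>stop k\<close>:
    the former involves earlier rounds only and stays constant while coordinate k is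
    resampled.\<close>
  define V where "V n w = (\<Prod>k\<in>{1..n}. if stop (k - 1) w then 1 else ennreal (exp (q k w)))" for n w
  have [measurable]: "V n \<in> borel_measurable ?O" for n
    unfolding V_def by measurable
  have stop_past: "stop m (w(n := z)) = stop m w" if "m < n" for m n w z
  proof -
    have "(\<Sum>s\<in>{1..k}. q s (w(n := z))) = (\<Sum>s\<in>{1..k}. q s w)" if "k \<le> m" for k
      using that \<open>m < n\<close> by (intro sum.cong past) auto
    then show ?thesis unfolding stop_def by simp
  qed
  have V_past: "V m (w(n := z)) = V m w" if "m < n" for m n w z
    unfolding V_def using that by (intro prod.cong) (auto simp: stop_past past)
  have V_Suc: "V (Suc n) w = V n w * (if stop n w then 1 else ennreal (exp (q (Suc n) w)))" for n w
    by (simp add: V_def)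
  have EV: "(\<integral>\<^sup>+w. V n w \<partial>?O) \<le> 1" for n
  proof (induction n)
    case 0
    then show ?case by (simp add: V_def O.emeasure_space_1)
  next
    case (Suc n)
    have "(\<integral>\<^sup>+w. V (Suc n) w \<partial>?O) = (\<integral>\<^sup>+w. (\<integral>\<^sup>+z. V (Suc n) (w(Suc n := z)) \<partial>M) \<partial>?O)"
      by (rule nn_integral_PiM_resample[OF M]) measurable
    also have "\<dots> \<le> (\<integral>\<^sup>+w. V n w \<partial>?O)"
    proof (rule nn_integral_mono)
      fix w assume w: "w \<in> space ?O"
      have upd: "(\<lambda>z. w(Suc n := z)) \<in> M \<rightarrow>\<^sub>M ?O"
        using w by (intro measurable_fun_upd[where J=UNIV]) auto
      have qm: "(\<lambda>z. q (Suc n) (w(Suc n := z))) \<in> borel_measurable M"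
        by (rule measurable_compose[OF upd q])
      have "(\<integral>\<^sup>+z. V (Suc n) (w(Suc n := z)) \<partial>M)
          = (\<integral>\<^sup>+z. V n w * (if stop n w then 1 else ennreal (exp (q (Suc n) (w(Suc n := z))))) \<partial>M)"
        by (simp add: V_Suc V_past stop_past)
      also have "\<dots> = V n w * (\<integral>\<^sup>+z. (if stop n w then 1 else ennreal (exp (q (Suc n) (w(Suc n := z))))) \<partial>M)"
        using qm by (intro nn_integral_cmult) auto
      also have "\<dots> \<le> V n w * 1"
        using step[of "Suc n", OF _ w] by (intro mult_left_mono) (cases "stop n w"; simp add: M.emeasure_space_1)+
      finally show "(\<integral>\<^sup>+z. V (Suc n) (w(Suc n := z)) \<partial>M) \<le> V n w" by simp
    qed
    finally show ?case using Suc.IH by simp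
  qed
  \<comment> \<open>Before stopping, V is the running exponential; from the crossing on it keeps its
    value, which is at least \<open>exp c\<close>. At n = 0 stopping means c \<le> 0, and then the
    empty product 1 is large enough.\<close>
  have VW: "(\<not> stop n w \<longrightarrow> V n w = ennreal (exp (\<Sum>s\<in>{1..n}. q s w)))
      \<and> (stop n w \<longrightarrow> ennreal (exp c) \<le> V n w)" for n w
  proof (induction n)
    case 0
    then show ?case by (auto simp: V_def stop_def ennreal_le_1)
  next
    case (Suc n)
    have st: "stop (Suc n) w \<longleftrightarrow> stop n w \<or> c \<le> (\<Sum>s\<in>{1..Suc n}. q s w)"
      unfolding stop_def by (auto simp: atMost_Suc simp del: sum.cl_ivl_Suc)
    show ?case
    proof (cases "stop n w")
      case True
      then show ?thesis using Suc.IH st by (simp add: V_Suc)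
    next
      case False
      then have "V (Suc n) w = ennreal (exp (\<Sum>s\<in>{1..Suc n}. q s w))"
        using Suc.IH by (simp add: V_Suc ennreal_mult[symmetric] exp_add[symmetric])
      then show ?thesis using False st by (auto intro!: ennreal_leI simp del: sum.cl_ivl_Suc)
    qed
  qed
  have bnd: "measure ?O {w\<in>space ?O. stop n w} \<le> exp (- c)" for n
  proof -
    have "ennreal (exp c) * emeasure ?O {w\<in>space ?O. stop n w}
        = (\<integral>\<^sup>+w. ennreal (exp c) * indicator {w\<in>space ?O. stop n w} w \<partial>?O)"
      by (rule nn_integral_cmult_indicator[symmetric]) measurable
    also have "\<dots> \<le> (\<integral>\<^sup>+w. V n w \<partial>?O)"
      using VW by (intro nn_integral_mono) (auto split: split_indicator)
    also have "\<dots> \<le> 1" by (rule EV)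
    finally have "exp c * measure ?O {w\<in>space ?O. stop n w} \<le> 1"
      by (simp add: O.emeasure_eq_measure ennreal_mult[symmetric])
    then show ?thesis
      by (simp add: exp_minus field_simps)
  qed
  \<comment> \<open>The bound for crossing by round n is uniform in n and these events increase, so
    it passes to an unbounded horizon.\<close>
  have inc: "incseq (\<lambda>n. {w\<in>space ?O. stop n w})"
    unfolding incseq_def stop_def by (auto intro: order_trans)
  have "(\<lambda>n. measure ?O {w\<in>space ?O. stop n w}) \<longlonglongrightarrow> measure ?O (\<Union>n. {w\<in>space ?O. stop n w})"
    by (rule O.finite_Lim_measure_incseq[OF _ inc]) auto
  then have "measure ?O (\<Union>n. {w\<in>space ?O. stop n w}) \<le> exp (- c)"
    using bnd by (intro LIMSEQ_le_const2) auto
  also have "(\<Union>n. {w\<in>space ?O. stop n w}) = {w\<in>space ?O. \<exists>n. c \<le> (\<Sum>s\<in>{1..n}. q s w)}"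
    unfolding stop_def by auto
  finally show ?thesis .
qed

section \<open>The law of one round and the product sample space\<close>

locale bandit =
  fixes F :: "real \<Rightarrow> real \<Rightarrow> real measure" and G :: "real pmf" and C :: "real \<times> real"
  assumes finite_G: "finite (set_pmf G)"
    and prob_F: "\<And>i x. x \<in> set_pmf G \<Longrightarrow> prob_space (F (par C i) x)"
    and sets_F: "\<And>i x. x \<in> set_pmf G \<Longrightarrow> sets (F (par C i) x) = sets borel"
begin

definition round_law where
  "round_law = measure_pmf G \<Otimes>\<^sub>M
    (PiM (set_pmf G) (\<lambda>x. F (fst C) x) \<Otimes>\<^sub>M PiM (set_pmf G) (\<lambda>x. F (snd C) x))"

definition rwd :: "nat \<Rightarrow> real \<times> (real \<Rightarrow> real) \<times> (real \<Rightarrow> real) \<Rightarrow> real" where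
  "rwd i z = (if i = 1 then fst (snd z) else snd (snd z)) (fst z)"

abbreviation "\<P> \<equiv> sspace F G C"

lemma sspace_eq: "\<P> = PiM UNIV (\<lambda>_. round_law)"
  by (simp add: sspace_def round_law_def)

lemma rew_eq: "rew w i t = rwd i (w t)"
  by (simp add: rew_def rwd_def Xs_def)

lemma prob_space_arm: "prob_space (PiM (set_pmf G) (\<lambda>x. F (par C i) x))"
  by (intro prob_space_PiM prob_F)

lemma prob_space_arms:
  "prob_space (PiM (set_pmf G) (\<lambda>x. F (fst C) x) \<Otimes>\<^sub>M PiM (set_pmf G) (\<lambda>x. F (snd C) x))"
  using prob_space_arm[of 1] prob_space_arm[of 2]
  by (intro prob_space_pair) (auto simp: par_def)

lemma prob_space_round: "prob_space round_law"
  unfolding round_law_def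
  by (intro prob_space_pair prob_space_arms measure_pmf.prob_space_axioms)

lemma prob_space_sspace: "prob_space \<P>"
  unfolding sspace_eq by (intro prob_space_PiM prob_space_round)

lemma measurable_reward_component:
  assumes "x \<in> set_pmf G"
  shows "(\<lambda>z. (if i = 1 then fst (snd z) else snd (snd z)) x) \<in> round_law \<rightarrow>\<^sub>M borel"
proof -
  have "(\<lambda>u. u x) \<in> PiM (set_pmf G) (\<lambda>x. F (par C k) x) \<rightarrow>\<^sub>M F (par C k) x" for k
    using assms by (rule measurable_component_singleton)
  then have comp: "(\<lambda>u. u x) \<in> PiM (set_pmf G) (\<lambda>x. F (par C k) x) \<rightarrow>\<^sub>M borel" for k
    using measurable_cong_sets[OF refl sets_F[OF assms]] by blast
  show ?thesis
  proof (cases "i = 1")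
    case True
    have "(\<lambda>z. fst (snd z)) \<in> round_law \<rightarrow>\<^sub>M PiM (set_pmf G) (\<lambda>x. F (par C 1) x)"
      unfolding round_law_def by (simp add: par_def)
    from measurable_compose[OF this comp] True show ?thesis by simp
  next
    case False
    have "(\<lambda>z. snd (snd z)) \<in> round_law \<rightarrow>\<^sub>M PiM (set_pmf G) (\<lambda>x. F (par C 2) x)"
      unfolding round_law_def by (simp add: par_def)
    from measurable_compose[OF this comp] False show ?thesis by simp
  qed
qed

lemma measurable_fst_round: "f \<in> UNIV \<rightarrow> space N \<Longrightarrow> (\<lambda>z. f (fst z)) \<in> round_law \<rightarrow>\<^sub>M N"
  unfolding round_law_def
  by (rule measurable_compose[OF measurable_fst]) auto

text \<open>The reward is a random function evaluated at a random covariate. Since the support is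
  finite, measurability follows by cases over the covariate; off the support, the extensional
  functions of the product take the value \<open>undefined\<close>.\<close>

lemma measurable_round:
  assumes f: "\<And>x. x \<in> set_pmf G \<Longrightarrow> f x \<in> borel \<rightarrow>\<^sub>M N" and N: "\<And>x y. f x y \<in> space N"
  shows "(\<lambda>z. f (fst z) (rwd i z)) \<in> round_law \<rightarrow>\<^sub>M N"
proof -
  obtain x0 where x0: "x0 \<in> set_pmf G" using set_pmf_not_empty[of G] by blast
  \<comment> \<open>Forces the covariate into the countable index set; the outer conditional below
    restores the value off the support.\<close>
  define g where "g z = (if fst z \<in> set_pmf G then fst z else x0)"
    for z :: "real \<times> (real \<Rightarrow> real) \<times> (real \<Rightarrow> real)"
  have g: "g \<in> round_law \<rightarrow>\<^sub>M count_space (set_pmf G)"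
    unfolding g_def using x0 by (intro measurable_fst_round) auto
  have m1: "(\<lambda>z. f (g z) ((if i = 1 then fst (snd z) else snd (snd z)) (g z))) \<in> round_law \<rightarrow>\<^sub>M N"
  proof (rule measurable_compose_countable'[OF _ g])
    fix x assume x: "x \<in> set_pmf G"
    show "(\<lambda>z. f x ((if i = 1 then fst (snd z) else snd (snd z)) x)) \<in> round_law \<rightarrow>\<^sub>M N"
      by (rule measurable_compose[OF measurable_reward_component[OF x] f[OF x]])
  qed (use finite_G in \<open>auto intro: countable_finite\<close>)
  have m2: "(\<lambda>z. f (fst z) undefined) \<in> round_law \<rightarrow>\<^sub>M N"
    using N by (intro measurable_fst_round) auto
  have m3: "Measurable.pred round_law (\<lambda>z. fst z \<in> set_pmf G)"
    by (intro measurable_fst_round) auto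
  have "(\<lambda>z. if fst z \<in> set_pmf G then f (g z) ((if i = 1 then fst (snd z) else snd (snd z)) (g z))
      else f (fst z) undefined) \<in> round_law \<rightarrow>\<^sub>M N"
    using m3 by (intro measurable_If m1 m2) (simp add: pred_def)
  also have "?this \<longleftrightarrow> ?thesis"
  proof (rule measurable_cong)
    fix z assume "z \<in> space round_law"
    then have "fst (snd z) \<in> extensional (set_pmf G)" "snd (snd z) \<in> extensional (set_pmf G)"
      by (auto simp: round_law_def space_pair_measure space_PiM PiE_def)
    then show "(if fst z \<in> set_pmf G then f (g z) ((if i = 1 then fst (snd z) else snd (snd z)) (g z))
      else f (fst z) undefined) = f (fst z) (rwd i z)"
      by (auto simp: rwd_def g_def extensional_def)
  qed
  finally show ?thesis .
qed

text \<open>Given the covariate x, the reward of arm i has law \<open>F (par C i) x\<close>, so by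
  Fubini it suffices to bound the integral separately at each covariate of the support.\<close>

lemma nn_integral_round_le_1:
  fixes f :: "real \<Rightarrow> real \<Rightarrow> ennreal"
  assumes f: "\<And>x. x \<in> set_pmf G \<Longrightarrow> f x \<in> borel_measurable borel"
    and le: "\<And>x. x \<in> set_pmf G \<Longrightarrow> (\<integral>\<^sup>+y. f x y \<partial>F (par C i) x) \<le> 1"
  shows "(\<integral>\<^sup>+z. f (fst z) (rwd i z) \<partial>round_law) \<le> 1"
proof -
  let ?A = "\<lambda>k. PiM (set_pmf G) (\<lambda>x. F (par C k) x)"
  have A12: "PiM (set_pmf G) (\<lambda>x. F (fst C) x) = ?A 1" "PiM (set_pmf G) (\<lambda>x. F (snd C) x) = ?A 2"
    by (simp_all add: par_def)
  interpret A1: prob_space "?A 1" by (rule prob_space_arm)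
  interpret A2: prob_space "?A 2" by (rule prob_space_arm)
  interpret A: prob_space "?A 1 \<Otimes>\<^sub>M ?A 2"
    using prob_space_arms by (simp add: A12)
  have comp: "(\<integral>\<^sup>+u. f x (u x) \<partial>?A k) = (\<integral>\<^sup>+y. f x y \<partial>F (par C k) x)" if x: "x \<in> set_pmf G" for x k
  proof -
    have "distr (?A k) (F (par C k) x) (\<lambda>u. u x) = F (par C k) x"
      using x prob_F by (intro distr_PiM_component)
    then have "(\<integral>\<^sup>+y. f x y \<partial>F (par C k) x) = (\<integral>\<^sup>+y. f x y \<partial>distr (?A k) (F (par C k) x) (\<lambda>u. u x))"
      by simp
    also have "\<dots> = (\<integral>\<^sup>+u. f x (u x) \<partial>?A k)"
      using x f[OF x] measurable_cong_sets[OF sets_F[OF x] refl, of k]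
      by (intro nn_integral_distr measurable_component_singleton) auto
    finally show ?thesis by simp
  qed
  have fm: "(\<lambda>u. f x (u x)) \<in> borel_measurable (?A k)" if x: "x \<in> set_pmf G" for x k
  proof -
    have "f x \<in> borel_measurable (F (par C k) x)"
      using f[OF x] measurable_cong_sets[OF sets_F[OF x] refl, of k] by blast
    then show ?thesis
      by (intro measurable_compose[OF measurable_component_singleton[OF x]])
  qed
  have inner: "(\<integral>\<^sup>+v. f x ((if i = 1 then fst v else snd v) x) \<partial>(?A 1 \<Otimes>\<^sub>M ?A 2)) \<le> 1"
    if x: "x \<in> set_pmf G" for x
  proof (cases "i = 1")
    case True
    have "(\<integral>\<^sup>+v. f x (fst v x) \<partial>(?A 1 \<Otimes>\<^sub>M ?A 2)) = (\<integral>\<^sup>+u. f x (u x) \<partial>distr (?A 1 \<Otimes>\<^sub>M ?A 2) (?A 1) fst)"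
      using fm[OF x] by (subst nn_integral_distr) auto
    also have "\<dots> = (\<integral>\<^sup>+u. f x (u x) \<partial>?A 1)"
      by (simp only: A2.distr_pair_fst)
    finally show ?thesis
      using le[OF x] True by (simp add: comp x)
  next
    case False
    have "(\<integral>\<^sup>+v. f x (snd v x) \<partial>(?A 1 \<Otimes>\<^sub>M ?A 2)) = (\<integral>\<^sup>+w. (\<integral>\<^sup>+u. f x (u x) \<partial>?A 2) \<partial>?A 1)"
      using measurable_compose[OF measurable_snd fm[OF x]]
      by (subst A2.nn_integral_fst[symmetric]) auto
    also have "\<dots> = (\<integral>\<^sup>+u. f x (u x) \<partial>?A 2)"
      by (simp add: A1.emeasure_space_1 del: One_nat_def)
    also have "\<dots> = (\<integral>\<^sup>+u. f x (u x) \<partial>?A i)"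
      using False by (simp add: par_def)
    finally show ?thesis
      using le[OF x] False by (simp add: comp x)
  qed
  have "(\<integral>\<^sup>+z. f (fst z) (rwd i z) \<partial>round_law)
      = (\<integral>\<^sup>+x. (\<integral>\<^sup>+v. f x ((if i = 1 then fst v else snd v) x) \<partial>(?A 1 \<Otimes>\<^sub>M ?A 2)) \<partial>measure_pmf G)"
    using measurable_round[of f borel i] f unfolding round_law_def A12
    by (cases "i = 1"; subst A.nn_integral_fst[symmetric]) (auto simp: rwd_def)
  also have "\<dots> \<le> (\<integral>\<^sup>+x. 1 \<partial>measure_pmf G)"
    using inner by (intro nn_integral_mono_AE) (auto simp: AE_measure_pmf_iff)
  finally show ?thesis by simp
qed

lemma measurable_coord: "(\<lambda>w. w t) \<in> \<P> \<rightarrow>\<^sub>M round_law"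
  unfolding sspace_eq by simp

lemma measurable_Xs_component: "(\<lambda>w. Xs w t) \<in> \<P> \<rightarrow>\<^sub>M count_space UNIV"
  unfolding Xs_def
  by (rule measurable_compose[OF measurable_coord measurable_fst_round]) auto

lemma measurable_Xs: "Xs \<in> \<P> \<rightarrow>\<^sub>M PiM UNIV (\<lambda>_. borel)"
proof -
  have "(\<lambda>w t. Xs w t) \<in> \<P> \<rightarrow>\<^sub>M PiM UNIV (\<lambda>_. borel)"
    by (intro measurable_PiM_single' measurable_compose[OF measurable_Xs_component]) auto
  then show ?thesis by simp
qed

lemma measurable_rew: "(\<lambda>w. rew w i t) \<in> borel_measurable \<P>"
  unfolding rew_eq
  by (rule measurable_compose[OF measurable_coord measurable_round[where f="\<lambda>_ y. y"]]) auto

lemma AE_Xs: "AE w in \<P>. \<forall>t. Xs w t \<in> set_pmf G"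
proof -
  have "AE w in \<P>. Xs w t \<in> set_pmf G" for t
  proof -
    have "AE z in round_law. fst z \<in> set_pmf G"
    proof -
      interpret A: prob_space "PiM (set_pmf G) (\<lambda>x. F (fst C) x) \<Otimes>\<^sub>M PiM (set_pmf G) (\<lambda>x. F (snd C) x)"
        by (rule prob_space_arms)
      have "AE x in distr round_law (measure_pmf G) fst. x \<in> set_pmf G"
        unfolding round_law_def A.distr_pair_fst by (simp add: AE_measure_pmf_iff)
      then show ?thesis
        by (rule AE_distrD[rotated]) (simp add: round_law_def)
    qed
    then show ?thesis
      unfolding Xs_def sspace_eq by (intro AE_PiM_component prob_space_round) auto
  qed
  then show ?thesis by (simp add: AE_all_countable)
qed

lemma Xs_upd: "Xs (w(n := z)) = (Xs w)(n := fst z)"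
  by (auto simp: Xs_def)

end

lemma hist_eq: "hist \<phi> w n k = (if 1 \<le> k \<and> k \<le> n then rew w (arm \<phi> w k) k else 0)"
  by (induction n) (auto simp: arm_def le_Suc_eq)

section \<open>Running a rule: non-anticipation and measurability\<close>

locale bandit_rule = bandit +
  fixes \<phi> :: "nat \<Rightarrow> (nat \<Rightarrow> real) \<Rightarrow> (nat \<Rightarrow> real) \<Rightarrow> nat"
  assumes rule: "alloc_rule \<phi>"
begin

lemma rule_range: "\<phi> t xs ys \<in> {1, 2}"
  using rule unfolding alloc_rule_def by blast

lemma rule_local:
  assumes "\<And>s. s \<in> {1..t} \<Longrightarrow> xs s = xs' s" "\<And>s. s \<in> {1..<t} \<Longrightarrow> ys s = ys' s"
  shows "\<phi> t xs ys = \<phi> t xs' ys'"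
proof -
  have "(\<forall>s\<in>{1..t}. xs s = xs' s) \<and> (\<forall>s\<in>{1..<t}. ys s = ys' s)" using assms by auto
  with rule show ?thesis unfolding alloc_rule_def by blast
qed

lemma arm_range: "arm \<phi> w t \<in> {1, 2}"
  unfolding arm_def by (rule rule_range)

lemma hist_past: "m < n \<Longrightarrow> hist \<phi> (w(n := z)) m = hist \<phi> w m"
proof (induction m)
  case (Suc m)
  have IH: "hist \<phi> (w(n := z)) m = hist \<phi> w m"
    by (rule Suc.IH) (use Suc.prems in simp)
  have rw: "rew (w(n := z)) i (Suc m) = rew w i (Suc m)" for i
    using Suc.prems by (simp add: rew_eq)
  have "\<phi> (Suc m) (Xs (w(n := z))) (hist \<phi> w m) = \<phi> (Suc m) (Xs w) (hist \<phi> w m)"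
    using Suc.prems by (intro rule_local) (auto simp: Xs_upd)
  then show ?case
    by (simp only: hist.simps IH rw)
qed simp

lemma arm_past: "t < n \<Longrightarrow> arm \<phi> (w(n := z)) t = arm \<phi> w t"
  unfolding arm_def by (subst hist_past) (auto intro!: rule_local simp: Xs_upd)

text \<open>The current coordinate enters the decision through its covariate alone. Once that is
  fixed, the arm is constant while the reward is integrated out.\<close>

lemma arm_present:
  "1 \<le> n \<Longrightarrow> arm \<phi> (w(n := z)) n = \<phi> n ((Xs w)(n := fst z)) (hist \<phi> w (n - 1))"
  unfolding arm_def by (subst hist_past) (auto simp: Xs_upd)

lemma measurable_rule_compose:
  assumes "f \<in> M \<rightarrow>\<^sub>M PiM UNIV (\<lambda>_. borel)" "g \<in> M \<rightarrow>\<^sub>M PiM UNIV (\<lambda>_. borel)"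
  shows "(\<lambda>w. \<phi> t (f w) (g w)) \<in> M \<rightarrow>\<^sub>M count_space UNIV"
proof -
  have "(\<lambda>(xs, ys). \<phi> t xs ys) \<in> PiM UNIV (\<lambda>_. borel) \<Otimes>\<^sub>M PiM UNIV (\<lambda>_. borel) \<rightarrow>\<^sub>M count_space UNIV"
    using rule unfolding alloc_rule_def by blast
  from measurable_compose[OF measurable_Pair[OF assms] this] show ?thesis by simp
qed

lemma measurable_hist: "hist \<phi> \<in> \<P> \<rightarrow>\<^sub>M PiM UNIV (\<lambda>_. PiM UNIV (\<lambda>_. borel))"
proof -
  have "(\<lambda>w. hist \<phi> w n) \<in> \<P> \<rightarrow>\<^sub>M PiM UNIV (\<lambda>_. borel)" for n
  proof (induction n)
    case (Suc n)
    let ?a = "\<lambda>w. \<phi> (Suc n) (Xs w) (hist \<phi> w n)"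
    have [measurable]: "?a \<in> \<P> \<rightarrow>\<^sub>M count_space UNIV"
      by (intro measurable_rule_compose measurable_Xs Suc)
    have eq: "rew w (?a w) (Suc n) = (if ?a w = 1 then rew w 1 (Suc n) else rew w 2 (Suc n))" for w
      by (simp add: rew_def)
    have m: "(\<lambda>w. if ?a w = 1 then rew w 1 (Suc n) else rew w 2 (Suc n)) \<in> borel_measurable \<P>"
      using measurable_rew[of 1] measurable_rew[of 2] by measurable
    show ?case
      unfolding hist.simps eq by (intro measurable_fun_upd[where J=UNIV] Suc m) auto
  qed (simp add: measurable_const space_PiM)
  then have "(\<lambda>w n. hist \<phi> w n) \<in> \<P> \<rightarrow>\<^sub>M PiM UNIV (\<lambda>_. PiM UNIV (\<lambda>_. borel))"
    by (intro measurable_PiM_single') (auto simp: space_PiM)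
  then show ?thesis by simp
qed

lemma measurable_hist_component: "(\<lambda>w. hist \<phi> w n) \<in> \<P> \<rightarrow>\<^sub>M PiM UNIV (\<lambda>_. borel)"
  by (rule measurable_compose[OF measurable_hist measurable_component_singleton]) simp

lemma measurable_arm: "arm \<phi> \<in> \<P> \<rightarrow>\<^sub>M PiM UNIV (\<lambda>_. count_space UNIV)"
proof -
  have "(\<lambda>w t. arm \<phi> w t) \<in> \<P> \<rightarrow>\<^sub>M PiM UNIV (\<lambda>_. count_space UNIV)"
    unfolding arm_def
    by (intro measurable_PiM_single' measurable_rule_compose measurable_Xs measurable_hist_component) auto
  then show ?thesis by simp
qed

lemma measurable_arm_component: "(\<lambda>w. arm \<phi> w t) \<in> \<P> \<rightarrow>\<^sub>M count_space UNIV"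
  by (rule measurable_compose[OF measurable_arm measurable_component_singleton]) simp

text \<open>Ville's inequality under adaptive sampling: a round in which another arm is pulled
  contributes the factor 1, and a pull of arm i contributes a factor whose mean, given the past and
  the covariate, is at most one. All numbers of rounds are covered simultaneously.\<close>

lemma prob_ex_arm_sum_ge_le_exp:
  fixes h :: "real \<Rightarrow> real \<Rightarrow> real"
  assumes h: "\<And>x. x \<in> set_pmf G \<Longrightarrow> h x \<in> borel_measurable borel"
    and le: "\<And>x. x \<in> set_pmf G \<Longrightarrow> (\<integral>\<^sup>+y. ennreal (exp (h x y)) \<partial>F (par C i) x) \<le> 1"
  shows "measure \<P> {w\<in>space \<P>. \<exists>n. c \<le> (\<Sum>s\<in>{1..n}. if arm \<phi> w s = i then h (Xs w s) (rew w i s) else 0)} \<le> exp (- c)"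
  unfolding sspace_eq
proof (rule prob_ex_sum_ge_le_exp[OF prob_space_round])
  fix n
  note [measurable] = measurable_arm_component
  have [measurable]: "(\<lambda>w. h (Xs w n) (rew w i n)) \<in> borel_measurable \<P>"
    unfolding rew_eq Xs_def
    by (rule measurable_compose[OF measurable_coord measurable_round[OF h]]) auto
  show "(\<lambda>w. if arm \<phi> w n = i then h (Xs w n) (rew w i n) else 0) \<in> borel_measurable (PiM UNIV (\<lambda>_. round_law))"
    unfolding sspace_eq[symmetric] by measurable
next
  fix m n w z assume "m < (n::nat)"
  then show "(if arm \<phi> (w(n := z)) m = i then h (Xs (w(n := z)) m) (rew (w(n := z)) i m) else 0)
      = (if arm \<phi> w m = i then h (Xs w m) (rew w i m) else 0)"
    by (simp add: arm_past Xs_upd rew_eq)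
next
  fix n w assume n: "1 \<le> (n::nat)"
  \<comment> \<open>The arm chosen in round n as a function of its covariate, with the past
    frozen.\<close>
  define d where "d x = \<phi> n ((Xs w)(n := x)) (hist \<phi> w (n - 1))" for x
  have "(\<integral>\<^sup>+z. ennreal (exp (if arm \<phi> (w(n := z)) n = i then h (Xs (w(n := z)) n) (rew (w(n := z)) i n) else 0)) \<partial>round_law)
      = (\<integral>\<^sup>+z. (\<lambda>x y. ennreal (exp (if d x = i then h x y else 0))) (fst z) (rwd i z) \<partial>round_law)"
    using n by (intro nn_integral_cong) (simp add: arm_present Xs_upd rew_eq d_def)
  also have "\<dots> \<le> 1"
  proof (rule nn_integral_round_le_1)
    fix x assume x: "x \<in> set_pmf G"
    interpret prob_space "F (par C i) x" by (rule prob_F[OF x])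
    show "(\<lambda>y. ennreal (exp (if d x = i then h x y else 0))) \<in> borel_measurable borel"
      using h[OF x] by measurable
    show "(\<integral>\<^sup>+y. ennreal (exp (if d x = i then h x y else 0)) \<partial>F (par C i) x) \<le> 1"
      using le[OF x] by (cases "d x = i") (simp_all add: emeasure_space_1)
  qed
  finally show "(\<integral>\<^sup>+z. ennreal (exp (if arm \<phi> (w(n := z)) n = i then h (Xs (w(n := z)) n) (rew (w(n := z)) i n) else 0)) \<partial>round_law) \<le> 1" .
qed

text \<open>An event that ignores round n is independent of the covariate of that round. It will
  show that an exploration covariate keeps occurring while the rule is misled.\<close>

lemma prob_past_and_covariate:
  assumes A: "Measurable.pred \<P> A" and past: "\<And>w z. A (w(n := z)) = A w"
  shows "measure \<P> {w\<in>space \<P>. A w \<and> Xs w n = x} = pmf G x * measure \<P> {w\<in>space \<P>. A w}"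
proof -
  interpret P: prob_space \<P> by (rule prob_space_sspace)
  interpret R: prob_space round_law by (rule prob_space_round)
  interpret A: prob_space "PiM (set_pmf G) (\<lambda>x. F (fst C) x) \<Otimes>\<^sub>M PiM (set_pmf G) (\<lambda>x. F (snd C) x)"
    by (rule prob_space_arms)
  note [measurable] = A measurable_Xs_component
  have fstm: "fst \<in> round_law \<rightarrow>\<^sub>M measure_pmf G" by (simp add: round_law_def)
  have X: "emeasure round_law (fst -` {x} \<inter> space round_law) = ennreal (pmf G x)"
  proof -
    have "emeasure round_law (fst -` {x} \<inter> space round_law) = emeasure (distr round_law (measure_pmf G) fst) {x}"
      using fstm by (subst emeasure_distr) auto
    then show ?thesis
      unfolding round_law_def A.distr_pair_fst by (simp add: emeasure_pmf_single)
  qed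
  have "emeasure \<P> {w\<in>space \<P>. A w \<and> Xs w n = x} = (\<integral>\<^sup>+w. indicator {w\<in>space \<P>. A w \<and> Xs w n = x} w \<partial>\<P>)"
    by (rule nn_integral_indicator[symmetric]) measurable
  also have "\<dots> = (\<integral>\<^sup>+w. (\<integral>\<^sup>+z. indicator {w\<in>space \<P>. A w \<and> Xs w n = x} (w(n := z)) \<partial>round_law) \<partial>\<P>)"
    unfolding sspace_eq by (rule nn_integral_PiM_resample[OF prob_space_round], unfold sspace_eq[symmetric]) measurable
  also have "\<dots> = (\<integral>\<^sup>+w. ennreal (pmf G x) * indicator {w\<in>space \<P>. A w} w \<partial>\<P>)"
  proof (rule nn_integral_cong)
    fix w assume w: "w \<in> space \<P>"
    have "(\<integral>\<^sup>+z. indicator {w\<in>space \<P>. A w \<and> Xs w n = x} (w(n := z)) \<partial>round_law)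
        = (\<integral>\<^sup>+z. indicator {w\<in>space \<P>. A w} w * indicator (fst -` {x} \<inter> space round_law) z \<partial>round_law)"
      using w by (intro nn_integral_cong)
        (auto simp: past Xs_upd sspace_eq space_PiM indicator_def)
    also have "\<dots> = indicator {w\<in>space \<P>. A w} w * ennreal (pmf G x)"
      using fstm by (subst nn_integral_cmult_indicator) (auto simp: X intro!: measurable_sets)
    finally show "(\<integral>\<^sup>+z. indicator {w\<in>space \<P>. A w \<and> Xs w n = x} (w(n := z)) \<partial>round_law)
      = ennreal (pmf G x) * indicator {w\<in>space \<P>. A w} w"
      by (simp add: mult.commute)
  qed
  also have "\<dots> = ennreal (pmf G x) * emeasure \<P> {w\<in>space \<P>. A w}"
    by (rule nn_integral_cmult_indicator) measurable
  finally show ?thesis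
    by (simp add: P.emeasure_eq_measure ennreal_mult[symmetric])
qed

end

section \<open>The allocation rule\<close>

locale bandit_family =
  fixes \<Theta> :: "real set" and F :: "real \<Rightarrow> real \<Rightarrow> real measure" and G :: "real pmf"
    and xst :: "real \<Rightarrow> real \<Rightarrow> real"
  assumes finite_covariates: "finite (set_pmf G)" and finite_\<Theta>: "finite \<Theta>"
    and prob_family: "\<And>\<theta> x. \<theta> \<in> \<Theta> \<Longrightarrow> x \<in> set_pmf G \<Longrightarrow> prob_space (F \<theta> x)"
    and sets_family: "\<And>\<theta> x. \<theta> \<in> \<Theta> \<Longrightarrow> x \<in> set_pmf G \<Longrightarrow> sets (F \<theta> x) = sets borel"
    and KL_fin: "\<And>\<theta> \<theta>' x. \<theta> \<in> \<Theta> \<Longrightarrow> \<theta>' \<in> \<Theta> \<Longrightarrow> \<theta> \<noteq> \<theta>' \<Longrightarrow> x \<in> set_pmf G \<Longrightarrow> KL_finite (F \<theta> x) (F \<theta>' x)"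
    and KL_pos: "\<And>\<theta> \<theta>' x. \<theta> \<in> \<Theta> \<Longrightarrow> \<theta>' \<in> \<Theta> \<Longrightarrow> \<theta> \<noteq> \<theta>' \<Longrightarrow> x \<in> set_pmf G \<Longrightarrow> 0 < KLnum (F \<theta> x) (F \<theta>' x)"
    and xst: "\<And>a b. a \<in> \<Theta> \<Longrightarrow> b \<in> \<Theta> \<Longrightarrow> xst a b \<in> set_pmf G"
begin

text \<open>Summing over the support instead of inserting x directly makes the function jointly
  Borel measurable in (x, y), whatever the dependence of F on x. On the support it is the logarithm
  of the density of \<open>F a x\<close> with respect to \<open>F b x\<close>.\<close>

definition llr :: "real \<Rightarrow> real \<Rightarrow> real \<Rightarrow> real \<Rightarrow> real" where
  "llr a b x y = (\<Sum>x'\<in>set_pmf G. indicator {x'} x * entropy_density (exp 1) (F b x') (F a x') y)"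

definition pulls :: "(nat \<Rightarrow> nat) \<Rightarrow> nat \<Rightarrow> nat \<Rightarrow> nat" where
  "pulls A i n = (\<Sum>s\<in>{1..n}. if A s = i then 1 else 0)"

definition Lam :: "(nat \<Rightarrow> nat) \<Rightarrow> (nat \<Rightarrow> real) \<Rightarrow> (nat \<Rightarrow> real) \<Rightarrow> nat \<Rightarrow> real \<Rightarrow> real \<Rightarrow> nat \<Rightarrow> real" where
  "Lam A xs ys i a b n = (\<Sum>s\<in>{1..n}. if A s = i then llr a b (xs s) (ys s) else 0)"

text \<open>\<open>good A xs ys i n \<theta>\<close> says that \<open>\<theta>\<close> is the strict maximum likelihood estimate for arm \<open>i\<close>
  after \<open>n\<close> rounds, expressed by pairwise tests so that only ratios \<open>dF\<^sub>a/dF\<^sub>b\<close> with \<open>a < b\<close> occur.\<close>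
definition good :: "(nat \<Rightarrow> nat) \<Rightarrow> (nat \<Rightarrow> real) \<Rightarrow> (nat \<Rightarrow> real) \<Rightarrow> nat \<Rightarrow> nat \<Rightarrow> real \<Rightarrow> bool" where
  "good A xs ys i n \<theta> \<longleftrightarrow>
    (\<forall>\<theta>'\<in>\<Theta>. (\<theta> < \<theta>' \<longrightarrow> 0 < Lam A xs ys i \<theta> \<theta>' n) \<and> (\<theta>' < \<theta> \<longrightarrow> Lam A xs ys i \<theta>' \<theta> n < 0))"

text \<open>Asymptotically \<open>ln t\<close>, yet \<open>exp (- level t)\<close> is summable.\<close>
definition level :: "nat \<Rightarrow> real" where
  "level t = ln (real t) + 2 * ln (1 + ln (real t))"

text \<open>After n rounds the decision concerns round n + 1, hence
  \<open>level (Suc n)\<close>.\<close>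

definition undecided :: "(nat \<Rightarrow> nat) \<Rightarrow> (nat \<Rightarrow> real) \<Rightarrow> (nat \<Rightarrow> real) \<Rightarrow> nat \<Rightarrow> nat \<Rightarrow> real \<Rightarrow> real \<Rightarrow> bool" where
  "undecided A xs ys j n a b \<longleftrightarrow> (\<exists>\<theta>\<in>\<Theta>. b < \<theta> \<and> Lam A xs ys j a \<theta> n < level (Suc n))"

definition leads :: "(nat \<Rightarrow> nat) \<Rightarrow> (nat \<Rightarrow> real) \<Rightarrow> (nat \<Rightarrow> real) \<Rightarrow> nat \<Rightarrow> nat \<Rightarrow> bool" where
  "leads A xs ys i n \<longleftrightarrow> (\<exists>a\<in>\<Theta>. \<exists>b\<in>\<Theta>. a < b \<and> good A xs ys (3 - i) n a \<and> good A xs ys i n b)"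

text \<open>Requiring strictly fewer pulls protects against a wrong estimate of the leader:
  exploratory pulls made under such an estimate still satisfy the count comparison that bounds their
  number.\<close>

definition explores :: "(nat \<Rightarrow> nat) \<Rightarrow> (nat \<Rightarrow> real) \<Rightarrow> (nat \<Rightarrow> real) \<Rightarrow> nat \<Rightarrow> nat \<Rightarrow> bool" where
  "explores A xs ys j n \<longleftrightarrow> pulls A j n < pulls A (3 - j) n \<and>
    (\<exists>a\<in>\<Theta>. \<exists>b\<in>\<Theta>. a < b \<and> good A xs ys j n a \<and> good A xs ys (3 - j) n b \<and>
      xs (Suc n) = xst a b \<and> undecided A xs ys j n a b)"

text \<open>At most one arm leads (\<open>leads_exclusive\<close>), so asking for arm 2 first
  expresses no preference.\<close>

definition decide :: "(nat \<Rightarrow> nat) \<Rightarrow> (nat \<Rightarrow> real) \<Rightarrow> (nat \<Rightarrow> real) \<Rightarrow> nat \<Rightarrow> nat" where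
  "decide A xs ys n =
    (if leads A xs ys 2 n then (if explores A xs ys 1 n then 1 else 2)
     else if leads A xs ys 1 n then (if explores A xs ys 2 n then 2 else 1)
     else if pulls A 1 n \<le> pulls A 2 n then 1 else 2)"

text \<open>A rule is given covariates and observed rewards but not its own past choices, so it has
  to reconstruct them recursively in order to attribute each reward to an arm.\<close>

fun arms :: "(nat \<Rightarrow> real) \<Rightarrow> (nat \<Rightarrow> real) \<Rightarrow> nat \<Rightarrow> nat \<Rightarrow> nat" where
  "arms xs ys 0 = (\<lambda>_. 0)"
| "arms xs ys (Suc n) = (arms xs ys n)(Suc n := decide (arms xs ys n) xs ys n)"

definition policy :: "nat \<Rightarrow> (nat \<Rightarrow> real) \<Rightarrow> (nat \<Rightarrow> real) \<Rightarrow> nat" where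
  "policy t xs ys = (if t = 0 then 1 else decide (arms xs ys (t - 1)) xs ys (t - 1))"

lemma policy_Suc: "policy (Suc n) xs ys = decide (arms xs ys n) xs ys n"
  by (simp add: policy_def)

lemma pulls_cong: "(\<And>s. s \<in> {1..n} \<Longrightarrow> A s = A' s) \<Longrightarrow> pulls A i n = pulls A' i n"
  unfolding pulls_def by (intro sum.cong) auto

lemma Lam_cong:
  assumes "\<And>s. s \<in> {1..n} \<Longrightarrow> A s = A' s" "\<And>s. s \<in> {1..n} \<Longrightarrow> xs s = xs' s"
    "\<And>s. s \<in> {1..n} \<Longrightarrow> ys s = ys' s"
  shows "Lam A xs ys i a b n = Lam A' xs' ys' i a b n"
  unfolding Lam_def using assms by (intro sum.cong) auto

lemma decide_cong:
  assumes A: "\<And>s. s \<in> {1..n} \<Longrightarrow> A s = A' s" and xs: "\<And>s. s \<in> {1..Suc n} \<Longrightarrow> xs s = xs' s"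
    and ys: "\<And>s. s \<in> {1..n} \<Longrightarrow> ys s = ys' s"
  shows "decide A xs ys n = decide A' xs' ys' n"
proof -
  have "pulls A i n = pulls A' i n" for i
    using A by (rule pulls_cong)
  moreover have "Lam A xs ys i a b n = Lam A' xs' ys' i a b n" for i a b
    using assms by (intro Lam_cong) auto
  moreover have "xs (Suc n) = xs' (Suc n)"
    using xs by simp
  ultimately show ?thesis
    unfolding decide_def leads_def explores_def undecided_def good_def by simp
qed

lemma arms_cong:
  assumes "\<And>s. s \<in> {1..n} \<Longrightarrow> xs s = xs' s" "\<And>s. s \<in> {1..<n} \<Longrightarrow> ys s = ys' s"
  shows "arms xs ys n = arms xs' ys' n"
  using assms
proof (induction n)
  case (Suc n)
  have "arms xs ys n = arms xs' ys' n"
    using Suc.prems by (intro Suc.IH) auto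
  moreover have "decide (arms xs' ys' n) xs ys n = decide (arms xs' ys' n) xs' ys' n"
    using Suc.prems by (intro decide_cong) auto
  ultimately show ?case by (simp only: arms.simps)
qed simp

section \<open>Measurability of the rule\<close>

lemma measurable_llr:
  assumes "a \<in> \<Theta>" "b \<in> \<Theta>"
  shows "(\<lambda>(x, y). llr a b x y) \<in> borel_measurable (borel \<Otimes>\<^sub>M borel)"
proof -
  have [measurable]: "entropy_density (exp 1) (F b x') (F a x') \<in> borel_measurable borel" if "x' \<in> set_pmf G" for x'
    using measurable_entropy_density[of "exp 1" "F b x'" "F a x'"] sets_family[of b x'] assms that
      measurable_cong_sets[of "F b x'" borel borel borel] by auto
  show ?thesis
    unfolding llr_def split_beta' by measurable
qed

lemma measurable_llr_y:
  assumes "a \<in> \<Theta>" "b \<in> \<Theta>"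
  shows "llr a b x \<in> borel_measurable borel"
  using measurable_compose[OF measurable_Pair1'[of x borel borel] measurable_llr[OF assms]] by simp

lemma measurable_pulls:
  assumes [measurable]: "A \<in> M \<rightarrow>\<^sub>M PiM UNIV (\<lambda>_. count_space UNIV)"
  shows "(\<lambda>w. pulls (A w) i n) \<in> borel_measurable M"
proof -
  have [measurable]: "(\<lambda>w. A w s) \<in> M \<rightarrow>\<^sub>M count_space UNIV" for s
    by (rule measurable_compose[OF assms measurable_component_singleton]) simp
  have "(\<lambda>w. pulls (A w) i n) \<in> M \<rightarrow>\<^sub>M count_space UNIV"
    unfolding pulls_def by measurable
  from measurable_compose[OF this, of "\<lambda>x. x" borel] show ?thesis by simp
qed

text \<open>Arms, covariates and rewards are arbitrary random sequences here, since the same facts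
  serve on two spaces: sequences of observations, for \<open>alloc_rule\<close>, and the sample
  space, for the statistics of the rule.\<close>

context
  fixes M :: "'w measure" and A :: "'w \<Rightarrow> nat \<Rightarrow> nat" and xs ys :: "'w \<Rightarrow> nat \<Rightarrow> real"
  assumes A: "A \<in> M \<rightarrow>\<^sub>M PiM UNIV (\<lambda>_. count_space UNIV)"
    and xs: "xs \<in> M \<rightarrow>\<^sub>M PiM UNIV (\<lambda>_. borel)" and ys: "ys \<in> M \<rightarrow>\<^sub>M PiM UNIV (\<lambda>_. borel)"
begin

lemma measurable_Lam:
  assumes ab: "a \<in> \<Theta>" "b \<in> \<Theta>"
  shows "(\<lambda>w. Lam (A w) (xs w) (ys w) i a b n) \<in> borel_measurable M"
proof -
  have [measurable]: "(\<lambda>w. A w s) \<in> M \<rightarrow>\<^sub>M count_space UNIV" for s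
    by (rule measurable_compose[OF A measurable_component_singleton]) simp
  have [measurable]: "(\<lambda>w. xs w s) \<in> borel_measurable M" "(\<lambda>w. ys w s) \<in> borel_measurable M" for s
    by (rule measurable_compose[OF xs measurable_component_singleton], simp)
       (rule measurable_compose[OF ys measurable_component_singleton], simp)
  have [measurable]: "(\<lambda>w. llr a b (xs w s) (ys w s)) \<in> borel_measurable M" for s
    using measurable_compose[OF _ measurable_llr[OF ab], of "\<lambda>w. (xs w s, ys w s)" M] by simp
  show ?thesis unfolding Lam_def by measurable
qed

lemma measurable_good: "\<theta> \<in> \<Theta> \<Longrightarrow> Measurable.pred M (\<lambda>w. good (A w) (xs w) (ys w) i n \<theta>)"
  unfolding good_def using finite_\<Theta> measurable_Lam
  by (intro pred_intros_finite pred_intros_logic) auto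

lemma measurable_undecided:
  "a \<in> \<Theta> \<Longrightarrow> Measurable.pred M (\<lambda>w. undecided (A w) (xs w) (ys w) j n a b)"
  unfolding undecided_def using finite_\<Theta> measurable_Lam
  by (intro pred_intros_finite pred_intros_logic) auto

lemma measurable_leads: "Measurable.pred M (\<lambda>w. leads (A w) (xs w) (ys w) i n)"
  unfolding leads_def using finite_\<Theta>
  by (intro pred_intros_finite pred_intros_logic measurable_good) auto

lemma measurable_explores: "Measurable.pred M (\<lambda>w. explores (A w) (xs w) (ys w) j n)"
proof -
  note [measurable] = measurable_pulls[OF A]
  have [measurable]: "(\<lambda>w. xs w (Suc n)) \<in> borel_measurable M"
    by (rule measurable_compose[OF xs measurable_component_singleton]) simp
  have p: "Measurable.pred M (\<lambda>w. pulls (A w) j n < pulls (A w) (3 - j) n)"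
    by measurable
  have x: "Measurable.pred M (\<lambda>w. xs w (Suc n) = c)" for c
    by measurable
  show ?thesis
    unfolding explores_def using finite_\<Theta>
    by (intro pred_intros_finite pred_intros_logic measurable_good measurable_undecided p x) auto
qed

lemma measurable_decide: "(\<lambda>w. decide (A w) (xs w) (ys w) n) \<in> M \<rightarrow>\<^sub>M count_space UNIV"
proof -
  note [measurable] = measurable_pulls[OF A] measurable_leads measurable_explores
  show ?thesis unfolding decide_def by measurable
qed

end

lemma measurable_arms:
  "(\<lambda>(xs, ys). arms xs ys n) \<in> PiM UNIV (\<lambda>_. borel) \<Otimes>\<^sub>M PiM UNIV (\<lambda>_. borel) \<rightarrow>\<^sub>M PiM UNIV (\<lambda>_. count_space UNIV)"
proof (induction n)
  case 0
  then show ?case by (simp add: space_PiM)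
next
  case (Suc n)
  have m: "(\<lambda>p. decide (case p of (xs, ys) \<Rightarrow> arms xs ys n) (fst p) (snd p) n)
      \<in> PiM UNIV (\<lambda>_. borel) \<Otimes>\<^sub>M PiM UNIV (\<lambda>_. borel) \<rightarrow>\<^sub>M count_space UNIV"
    by (intro measurable_decide Suc measurable_fst measurable_snd)
  show ?case
    using Suc m unfolding arms.simps split_beta'
    by (intro measurable_fun_upd[where J=UNIV]) auto
qed

lemma alloc_rule_policy: "alloc_rule policy"
  unfolding alloc_rule_def
proof (intro conjI allI impI)
  show "policy t xs ys \<in> {1, 2}" for t xs ys
    by (auto simp: policy_def decide_def)
next
  fix t :: nat and xs ys xs' ys' :: "nat \<Rightarrow> real"
  assume h: "(\<forall>s\<in>{1..t}. xs s = xs' s) \<and> (\<forall>s\<in>{1..<t}. ys s = ys' s)"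
  show "policy t xs ys = policy t xs' ys'"
  proof (cases t)
    case (Suc n)
    have "arms xs ys n = arms xs' ys' n"
      using h Suc by (intro arms_cong) auto
    moreover have "decide (arms xs' ys' n) xs ys n = decide (arms xs' ys' n) xs' ys' n"
      using h Suc by (intro decide_cong) auto
    ultimately show ?thesis by (simp add: policy_def Suc)
  qed (simp add: policy_def)
next
  fix t
  have "(\<lambda>p. decide (case p of (xs, ys) \<Rightarrow> arms xs ys (t - 1)) (fst p) (snd p) (t - 1))
      \<in> PiM UNIV (\<lambda>_. borel) \<Otimes>\<^sub>M PiM UNIV (\<lambda>_. borel) \<rightarrow>\<^sub>M count_space UNIV"
    by (intro measurable_decide measurable_arms measurable_fst measurable_snd)
  then show "(\<lambda>(xs, ys). policy t xs ys) \<in> PiM UNIV (\<lambda>_. borel) \<Otimes>\<^sub>M PiM UNIV (\<lambda>_. borel) \<rightarrow>\<^sub>M count_space UNIV"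
    unfolding policy_def split_beta' by (cases "t = 0") auto
qed

section \<open>The rule fed with its own observations\<close>

definition Ys :: "(nat \<Rightarrow> real \<times> (real \<Rightarrow> real) \<times> (real \<Rightarrow> real)) \<Rightarrow> nat \<Rightarrow> real" where
  "Ys w s = rew w (arm policy w s) s"

lemma arms_hist: "s \<in> {1..n} \<Longrightarrow> arms (Xs w) (hist policy w n) n s = arm policy w s"
proof (induction n arbitrary: s)
  case (Suc n)
  \<comment> \<open>Enlarging the history by the reward of round n + 1 cannot alter the arms of the
    first n rounds.\<close>
  have eq: "arms (Xs w) (hist policy w (Suc n)) n = arms (Xs w) (hist policy w n) n"
    by (intro arms_cong) (auto simp: hist_eq)
  show ?case
  proof (cases "s = Suc n")
    case True
    have "arms (Xs w) (hist policy w (Suc n)) (Suc n) (Suc n)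
        = decide (arms (Xs w) (hist policy w n) n) (Xs w) (hist policy w (Suc n)) n"
      by (simp only: arms.simps eq fun_upd_same)
    also have "\<dots> = decide (arms (Xs w) (hist policy w n) n) (Xs w) (hist policy w n) n"
      by (intro decide_cong) (auto simp: hist_eq)
    finally show ?thesis
      by (simp only: True arm_def policy_Suc diff_Suc_1)
  next
    case False
    then show ?thesis
      using Suc by (simp only: arms.simps eq fun_upd_other) auto
  qed
qed simp

text \<open>Closes the loop: the actual arms satisfy the recursion of \<open>decide\<close> on every
  path, so the analysis can forget the reconstruction.\<close>

lemma arm_policy_Suc: "arm policy w (Suc n) = decide (arm policy w) (Xs w) (Ys w) n"
proof -
  have "arm policy w (Suc n) = decide (arms (Xs w) (hist policy w n) n) (Xs w) (hist policy w n) n"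
    by (simp add: arm_def policy_Suc)
  also have "\<dots> = decide (arm policy w) (Xs w) (Ys w) n"
    by (intro decide_cong arms_hist) (auto simp: hist_eq Ys_def)
  finally show ?thesis .
qed

text \<open>Two candidates are compared through a single statistic, and their tests demand opposite
  strict signs of it. Uniqueness therefore holds on every path; exchanging numerator and denominator
  of a density would negate the logarithm only almost everywhere.\<close>

lemma good_unique:
  assumes "good A xs ys i n \<theta>" "good A xs ys i n \<theta>'" "\<theta> \<in> \<Theta>" "\<theta>' \<in> \<Theta>"
  shows "\<theta> = \<theta>'"
proof (cases \<theta> \<theta>' rule: linorder_cases)
  case less
  then have "0 < Lam A xs ys i \<theta> \<theta>' n" "Lam A xs ys i \<theta> \<theta>' n < 0"
    using assms unfolding good_def by blast+
  then show ?thesis by simp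
next
  case greater
  then have "0 < Lam A xs ys i \<theta>' \<theta> n" "Lam A xs ys i \<theta>' \<theta> n < 0"
    using assms unfolding good_def by blast+
  then show ?thesis by simp
qed simp

section \<open>Exponential moments of the log-likelihood ratio\<close>

lemma llr_eq: "x \<in> set_pmf G \<Longrightarrow> llr a b x y = entropy_density (exp 1) (F b x) (F a x) y"
  unfolding llr_def using finite_covariates by (subst sum.remove[of _ x]) (auto simp: indicator_def intro!: sum.neutral)

lemma nn_integral_exp_llr:
  assumes ab: "a \<in> \<Theta>" "b \<in> \<Theta>" "a \<noteq> b" and x: "x \<in> set_pmf G" and g: "g \<in> borel_measurable borel"
  shows "(\<integral>\<^sup>+y. g y * ennreal (exp (llr a b x y)) \<partial>F b x) = (\<integral>\<^sup>+y. g y \<partial>F a x)"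
proof -
  have "g \<in> borel_measurable (F b x)"
    using g measurable_cong_sets[OF sets_family[of b x] refl] ab x by blast
  moreover have "absolutely_continuous (F b x) (F a x)" "absolutely_continuous (F a x) (F b x)"
    using KL_fin[of a b x] KL_fin[of b a x] ab x by (auto simp: KL_finite_def)
  ultimately show ?thesis
    unfolding llr_eq[OF x] using ab x prob_family sets_family by (intro nn_integral_exp_entropy_density) auto
qed

text \<open>The exponent s must not depend on the covariate, so that it can be factored out of a sum
  over rounds; a finite support permits this. The rate \<kappa> may depend on the covariate, as
  needed when only one covariate is to be credited.\<close>

lemma ex_nn_integral_exp_llr_le_1:
  assumes ab: "a \<in> \<Theta>" "b \<in> \<Theta>" "a \<noteq> b"
    and \<kappa>: "\<And>x. x \<in> set_pmf G \<Longrightarrow> \<kappa> x < KLnum (F a x) (F b x)"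
  obtains s :: real where "0 < s" "s \<le> 1" "\<And>x. x \<in> set_pmf G \<Longrightarrow> (\<integral>\<^sup>+y. ennreal (exp (- s * (llr a b x y - \<kappa> x))) \<partial>F a x) \<le> 1"
proof -
  have "\<forall>\<^sub>F n in sequentially. \<forall>x\<in>set_pmf G.
      (\<integral>\<^sup>+y. ennreal (exp (- inverse (real (Suc n)) * (llr a b x y - \<kappa> x))) \<partial>F a x) \<le> 1"
  proof (intro eventually_ball_finite finite_covariates ballI eventually_nn_integral_exp_le_1)
    fix x assume x: "x \<in> set_pmf G"
    interpret Q: prob_space "F b x" using ab x by (intro prob_family)
    show "prob_space (F a x)" using ab x by (intro prob_family)
    have "llr a b x = entropy_density (exp 1) (F b x) (F a x)"
      using llr_eq[OF x] by (rule ext)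
    then show "integrable (F a x) (llr a b x)"
      using KL_fin[of a b x] ab x by (simp add: KL_finite_def)
    show "\<kappa> x < (\<integral>y. llr a b x y \<partial>F a x)"
      using \<kappa>[OF x] by (simp add: KLnum_def KL_divergence_def llr_eq[OF x])
    have "(\<integral>\<^sup>+y. ennreal (exp (- llr a b x y)) \<partial>F a x)
        = (\<integral>\<^sup>+y. ennreal (exp (- llr a b x y)) * ennreal (exp (llr a b x y)) \<partial>F b x)"
      using measurable_llr_y[OF ab(1,2), of x] by (intro nn_integral_exp_llr[symmetric] ab x) measurable
    also have "\<dots> = 1"
      by (simp add: ennreal_mult[symmetric] exp_add[symmetric] Q.emeasure_space_1)
    finally show "(\<integral>\<^sup>+y. ennreal (exp (- llr a b x y)) \<partial>F a x) \<le> 1" by simp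
  qed
  then obtain n where "\<forall>x\<in>set_pmf G.
      (\<integral>\<^sup>+y. ennreal (exp (- inverse (real (Suc n)) * (llr a b x y - \<kappa> x))) \<partial>F a x) \<le> 1"
    by (auto simp only: eventually_sequentially)
  then show thesis
    by (intro that[of "inverse (real (Suc n))"]) (auto simp: inverse_le_1_iff)
qed

lemma ex_KL_lower_bound:
  assumes "a \<in> \<Theta>" "b \<in> \<Theta>" "a \<noteq> b"
  obtains \<kappa> :: real where "0 < \<kappa>" "\<And>x. x \<in> set_pmf G \<Longrightarrow> \<kappa> < KLnum (F a x) (F b x)"
proof -
  define m where "m = Min ((\<lambda>x. KLnum (F a x) (F b x)) ` set_pmf G)"
  have "0 < m"
    unfolding m_def using finite_covariates set_pmf_not_empty KL_pos assms by (subst Min_gr_iff) auto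
  moreover have "m \<le> KLnum (F a x) (F b x)" if "x \<in> set_pmf G" for x
    unfolding m_def using finite_covariates that by (intro Min_le) auto
  ultimately show thesis
    by (intro that[of "m / 2"]) fastforce+
qed

section \<open>Pathwise reasons for pulling the inferior arm\<close>

lemma leads_exclusive:
  assumes "leads A xs ys i n" "i \<in> {1, 2}"
  shows "\<not> leads A xs ys (3 - i) n"
proof
  assume "leads A xs ys (3 - i) n"
  with assms(2) obtain a b where "a \<in> \<Theta>" "b \<in> \<Theta>" "a < b" "good A xs ys i n a" "good A xs ys (3 - i) n b"
    unfolding leads_def by auto
  moreover obtain a' b' where "a' \<in> \<Theta>" "b' \<in> \<Theta>" "a' < b'" "good A xs ys (3 - i) n a'" "good A xs ys i n b'"
    using assms(1) unfolding leads_def by auto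
  ultimately show False
    using good_unique[of A xs ys i n a b'] good_unique[of A xs ys "3 - i" n b a'] by auto
qed

lemma decide_leads:
  assumes "leads A xs ys i n" "i \<in> {1, 2}"
  shows "decide A xs ys n = (if explores A xs ys (3 - i) n then 3 - i else i)"
  using assms leads_exclusive[OF assms] unfolding decide_def by auto

lemma decide_no_leader:
  assumes "\<not> leads A xs ys i n" "\<not> leads A xs ys (3 - i) n" "i \<in> {1, 2}" "decide A xs ys n = i"
  shows "pulls A i n \<le> pulls A (3 - i) n"
  using assms unfolding decide_def by (auto split: if_splits)

text \<open>With both estimates correct the superior arm leads, and only exploration pulls
  \<open>j\<close>. If only the estimate of the superior arm is wrong, then either \<open>j\<close>
  is not ahead in pulls, or \<open>j\<close> itself must lead with its correct estimate. Each case
  matches one counting bound.\<close>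

lemma decide_inferior_cases:
  assumes dec: "decide A xs ys n = j" and j: "j \<in> {1, 2}"
    and \<theta>: "\<theta>j \<in> \<Theta>" "\<theta>l \<in> \<Theta>" "\<theta>j < \<theta>l"
  obtains (wrong) "\<not> good A xs ys j n \<theta>j"
    | (behind) "pulls A j n \<le> pulls A (3 - j) n" "\<not> good A xs ys (3 - j) n \<theta>l"
    | (explore) "xs (Suc n) = xst \<theta>j \<theta>l" "undecided A xs ys j n \<theta>j \<theta>l"
    | (misled) a where "a \<in> \<Theta>" "a < \<theta>j" "good A xs ys (3 - j) n a" "good A xs ys j n \<theta>j"
        "pulls A (3 - j) n < pulls A j n"
proof -
  let ?l = "3 - j"
  have l: "?l \<in> {1, 2}" "3 - ?l = j" using j by auto
  show thesis
  proof (cases "good A xs ys j n \<theta>j")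
    case gj: True
    show thesis
    proof (cases "good A xs ys ?l n \<theta>l")
      case gl: True
      then have "leads A xs ys ?l n"
        using gj \<theta> l unfolding leads_def by auto
      from decide_leads[OF this l(1)] have "explores A xs ys j n"
        using dec l j by (auto split: if_splits)
      then obtain a b where ab: "a \<in> \<Theta>" "b \<in> \<Theta>" "good A xs ys j n a" "good A xs ys ?l n b"
        "xs (Suc n) = xst a b" "undecided A xs ys j n a b"
        unfolding explores_def by auto
      then have "a = \<theta>j" "b = \<theta>l"
        using gj gl \<theta> good_unique by blast+
      then show thesis using ab explore by simp
    next
      case gl: False
      show thesis
      proof (cases "pulls A j n \<le> pulls A ?l n")
        case True
        then show thesis using gl behind by simp
      next
        case False
        have nl: "\<not> leads A xs ys ?l n"
        proof
          assume "leads A xs ys ?l n"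
          from decide_leads[OF this l(1)] have "explores A xs ys j n"
            using dec l j by (auto split: if_splits)
          then show False using False unfolding explores_def by simp
        qed
        \<comment> \<open>Arm \<open>j\<close> was chosen despite having more pulls, which cannot
          happen without a leader.\<close>
        moreover have "leads A xs ys j n"
          using decide_no_leader[OF _ nl j dec] False by auto
        then obtain a b where ab: "a \<in> \<Theta>" "b \<in> \<Theta>" "a < b" "good A xs ys ?l n a" "good A xs ys j n b"
          unfolding leads_def by auto
        then have "b = \<theta>j" using gj \<theta> good_unique by blast
        then show thesis using ab misled[of a] False by simp
      qed
    qed
  qed (rule wrong)
qed

text \<open>The way out of a false lead: at the right covariate the underestimated arm is pulled
  while its estimate is wrong, and pulls of that kind are rare.\<close>

lemma decide_misled:
  assumes j: "j \<in> {1, 2}" and \<theta>: "\<theta>j \<in> \<Theta>" "\<theta>l \<in> \<Theta>" "\<theta>j < \<theta>l"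
    and a: "a \<in> \<Theta>" "a < \<theta>j" "good A xs ys (3 - j) n a" "good A xs ys j n \<theta>j"
      "pulls A (3 - j) n < pulls A j n" "undecided A xs ys (3 - j) n a \<theta>j" "xs (Suc n) = xst a \<theta>j"
  shows "decide A xs ys n = 3 - j" "\<not> good A xs ys (3 - j) n \<theta>l"
proof -
  have "leads A xs ys j n"
    using a \<theta> unfolding leads_def by auto
  moreover have "3 - (3 - j) = j" using j by auto
  then have "explores A xs ys (3 - j) n"
    using a \<theta> unfolding explores_def by auto
  ultimately show "decide A xs ys n = 3 - j"
    using decide_leads[of A xs ys j n] j by simp
  show "\<not> good A xs ys (3 - j) n \<theta>l"
    using good_unique[of A xs ys "3 - j" n a \<theta>l] a \<theta> by auto
qed

lemma pulls_Suc: "pulls A i (Suc n) = pulls A i n + (if A (Suc n) = i then 1 else 0)"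
  by (simp add: pulls_def)

end

section \<open>Counting rounds by the counters they advance\<close>

lemma counter_strict:
  fixes c :: "nat \<Rightarrow> nat"
  assumes "mono c" "c (t - 1) < c t" "t < t'"
  shows "c (t - 1) < c (t' - 1)"
proof -
  have "t \<le> t' - 1" using assms(3) by linarith
  from monoD[OF assms(1) this] assms(2) show ?thesis by linarith
qed

lemma inj_on_counter:
  fixes c :: "nat \<Rightarrow> nat"
  assumes "mono c" "\<And>t. t \<in> D \<Longrightarrow> c (t - 1) < c t"
  shows "inj_on (\<lambda>t. c (t - 1)) D"
proof (rule linorder_inj_onI')
  fix t t' assume "t \<in> D" "t < t'"
  then show "c (t - 1) \<noteq> c (t' - 1)"
    using counter_strict[of c t t'] assms by auto
qed

text \<open>Rounds that advance a counter see distinct earlier values of it, so a count over time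
  becomes a sum over sample sizes.\<close>

lemma card_le_sum_counter:
  fixes c :: "nat \<Rightarrow> nat"
  assumes D: "D \<subseteq> {1..T}" and c: "mono c" "\<And>t. t \<in> D \<Longrightarrow> c (t - 1) < c t" "\<And>n. c n \<le> n"
    and B: "\<And>t. t \<in> D \<Longrightarrow> B (c (t - 1))"
  shows "card D \<le> (\<Sum>m<T. of_bool (B m))"
proof -
  have "card D = card ((\<lambda>t. c (t - 1)) ` D)"
    using inj_on_counter[OF c(1,2)] by (simp add: card_image)
  also have "\<dots> \<le> card {m\<in>{..<T}. B m}"
  proof (rule card_mono)
    show "(\<lambda>t. c (t - 1)) ` D \<subseteq> {m\<in>{..<T}. B m}"
    proof safe
      fix t assume t: "t \<in> D"
      then have "1 \<le> t" "t \<le> T" using D by auto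
      then show "c (t - 1) < T" using c(3)[of "t - 1"] by auto
    qed (rule B)
  qed simp
  also have "\<dots> = (\<Sum>m<T. of_bool (B m))"
    by (simp add: of_bool_def sum.If_cases Int_def)
  finally show ?thesis .
qed

text \<open>The counter \<open>d\<close> that carries the condition may stand still, but the
  advancing counter \<open>c\<close> takes at most m + 1 values while \<open>d\<close> equals m and
  bounds it. This is the origin of the weight \<open>Suc m\<close>.\<close>

lemma card_le_sum_two_counters:
  fixes c d :: "nat \<Rightarrow> nat"
  assumes D: "D \<subseteq> {1..T}" and c: "mono c" "\<And>t. t \<in> D \<Longrightarrow> c (t - 1) < c t"
    and d: "\<And>n. d n \<le> n" and le: "\<And>t. t \<in> D \<Longrightarrow> c (t - 1) \<le> d (t - 1)"
    and B: "\<And>t. t \<in> D \<Longrightarrow> B (d (t - 1))"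
  shows "card D \<le> (\<Sum>m<T. Suc m * of_bool (B m))"
proof -
  have "inj_on (\<lambda>t. (d (t - 1), c (t - 1))) D"
    using inj_on_counter[OF c] by (auto simp: inj_on_def)
  then have "card D = card ((\<lambda>t. (d (t - 1), c (t - 1))) ` D)"
    by (simp add: card_image)
  also have "\<dots> \<le> card (SIGMA m:{m\<in>{..<T}. B m}. {..m})"
  proof (rule card_mono)
    show "(\<lambda>t. (d (t - 1), c (t - 1))) ` D \<subseteq> (SIGMA m:{m\<in>{..<T}. B m}. {..m})"
    proof safe
      fix t assume t: "t \<in> D"
      then have "1 \<le> t" "t \<le> T" using D by auto
      then show "d (t - 1) < T" using d[of "t - 1"] by auto
      show "c (t - 1) \<le> d (t - 1)" using le[OF t] by simp
    qed (rule B)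
  qed auto
  also have "\<dots> = (\<Sum>m\<in>{m\<in>{..<T}. B m}. Suc m)"
    by (subst card_SigmaI) auto
  also have "\<dots> = (\<Sum>m<T. Suc m * of_bool (B m))"
    by (subst sum.inter_filter) (auto intro!: sum.cong)
  finally show ?thesis .
qed

section \<open>Deviation bounds\<close>

lemma summable_Suc_mult_exp:
  fixes d :: real
  assumes "0 < d"
  shows "summable (\<lambda>m. real (Suc m) * exp (- d * real m))"
proof -
  have "summable (\<lambda>m. real (Suc m) * exp (- d) ^ m)"
    using geometric_deriv_sums[of "exp (- d)"] assms by (auto simp: sums_iff)
  moreover have "exp (- d) ^ m = exp (- d * real m)" for m
    by (simp add: exp_of_nat2_mult[symmetric] mult.commute)
  ultimately show ?thesis by simp
qed

text \<open>By Cauchy condensation: at powers of 2 the terms, multiplied by \<open>2 ^ n\<close>,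
  become the inverse square of 1 + n ln 2. The coefficient 2 of the iterated logarithm produces this
  square.\<close>

lemma summable_exp_level: "summable (\<lambda>t. exp (- (ln (real t) + 2 * ln (1 + ln (real t)))))"
proof -
  let ?f = "\<lambda>t::nat. exp (- (ln (real t) + 2 * ln (1 + ln (real t))))"
  have "summable ?f \<longleftrightarrow> summable (\<lambda>n. 2 ^ n * ?f (2 ^ n))"
  proof (rule condensation_test)
    fix m :: nat assume "0 < m"
    then have "ln (real m) \<le> ln (real (Suc m))" "0 \<le> ln (real m)" by auto
    moreover from this have "ln (1 + ln (real m)) \<le> ln (1 + ln (real (Suc m)))"
      by (subst ln_le_cancel_iff) auto
    ultimately show "?f (Suc m) \<le> ?f m"
      unfolding exp_le_cancel_iff by linarith
  qed simp
  also have "summable (\<lambda>n. 2 ^ n * ?f (2 ^ n))"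
  proof (rule summable_comparison_test')
    show "summable (\<lambda>n. inverse ((ln 2)\<^sup>2) * inverse (real n ^ 2))"
      by (intro summable_mult inverse_power_summable) simp
    fix n :: nat assume n: "1 \<le> n"
    have pos: "0 < 1 + real n * ln 2" by (simp add: add_pos_nonneg)
    have "2 ^ n * ?f (2 ^ n) = 2 ^ n * (exp (- ln (2 ^ n)) * exp (- (2 * ln (1 + ln (2 ^ n)))))"
      by (simp add: exp_add[symmetric])
    also have "\<dots> = exp (- (2 * ln (1 + real n * ln 2)))"
      by (simp add: exp_minus ln_realpow exp_of_nat_mult)
    also have "\<dots> = inverse ((1 + real n * ln 2)\<^sup>2)"
      using pos by (simp add: exp_minus exp_double)
    also have "\<dots> \<le> inverse ((real n * ln 2)\<^sup>2)"
      using n by (intro le_imp_inverse_le power_mono) auto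
    finally show "norm (2 ^ n * ?f (2 ^ n)) \<le> inverse ((ln 2)\<^sup>2) * inverse (real n ^ 2)"
      by (simp add: power_mult_distrib mult.commute)
  qed
  finally show ?thesis .
qed

section \<open>The statistics of the rule under a fixed configuration\<close>

locale bandit_config = bandit_family +
  fixes C :: "real \<times> real"
  assumes C: "fst C \<in> \<Theta>" "snd C \<in> \<Theta>"
begin

lemma par_in: "par C i \<in> \<Theta>"
  using C by (auto simp: par_def)

sublocale bandit_rule F G C policy
  by (intro bandit_rule.intro bandit.intro bandit_rule_axioms.intro)
    (rule finite_covariates alloc_rule_policy prob_family sets_family par_in | assumption)+

sublocale P: prob_space \<P>
  by (rule prob_space_sspace)

definition "plls i n w = pulls (arm policy w) i n"
definition "lam i a b n w = Lam (arm policy w) (Xs w) (Ys w) i a b n"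
definition "gd i n \<theta> w = good (arm policy w) (Xs w) (Ys w) i n \<theta>"

definition "beaten i \<theta> n w \<longleftrightarrow>
  (if par C i < \<theta> then 0 < lam i (par C i) \<theta> n w else lam i \<theta> (par C i) n w < 0)"

lemma gd_par_iff: "gd i n (par C i) w \<longleftrightarrow> (\<forall>\<theta>\<in>\<Theta> - {par C i}. beaten i \<theta> n w)"
proof -
  have "((p < q \<longrightarrow> A) \<and> (q < p \<longrightarrow> B)) \<longleftrightarrow> (q \<noteq> p \<longrightarrow> (if p < q then A else B))" for p q :: real and A B
    by auto
  then show ?thesis
    unfolding gd_def good_def beaten_def lam_def by blast
qed

lemma measurable_Ys: "Ys \<in> \<P> \<rightarrow>\<^sub>M PiM UNIV (\<lambda>_. borel)"
proof -
  have "(\<lambda>w. Ys w s) \<in> borel_measurable \<P>" for s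
  proof -
    have "Ys w s = (if arm policy w s = 1 then rew w 1 s else rew w 2 s)" for w
      by (simp add: Ys_def rew_def)
    moreover have "(\<lambda>w. if arm policy w s = 1 then rew w 1 s else rew w 2 s) \<in> borel_measurable \<P>"
      using measurable_arm_component[of s] measurable_rew[of 1 s] measurable_rew[of 2 s] by measurable
    ultimately show ?thesis by simp
  qed
  then have "(\<lambda>w s. Ys w s) \<in> \<P> \<rightarrow>\<^sub>M PiM UNIV (\<lambda>_. borel)"
    by (intro measurable_PiM_single') auto
  then show ?thesis by simp
qed

lemma measurable_plls [measurable]: "plls i n \<in> \<P> \<rightarrow>\<^sub>M count_space UNIV"
proof -
  note [measurable] = measurable_arm_component
  show ?thesis unfolding plls_def[abs_def] pulls_def by measurable
qed

lemma measurable_plls_borel [measurable]: "plls i n \<in> borel_measurable \<P>"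
  using measurable_pulls[OF measurable_arm] unfolding plls_def[abs_def] by simp

lemma measurable_lam [measurable]: "a \<in> \<Theta> \<Longrightarrow> b \<in> \<Theta> \<Longrightarrow> lam i a b n \<in> borel_measurable \<P>"
  using measurable_Lam[OF measurable_arm measurable_Xs measurable_Ys] unfolding lam_def[abs_def] by simp

lemma measurable_gd [measurable]: "\<theta> \<in> \<Theta> \<Longrightarrow> Measurable.pred \<P> (gd i n \<theta>)"
  using measurable_good[OF measurable_arm measurable_Xs measurable_Ys] unfolding gd_def[abs_def] by simp

lemma measurable_beaten [measurable]: "\<theta> \<in> \<Theta> \<Longrightarrow> Measurable.pred \<P> (beaten i \<theta> n)"
  using measurable_lam[OF par_in] measurable_lam[OF _ par_in] unfolding beaten_def[abs_def] by measurable

lemma lam_eq: "lam i a b n w = (\<Sum>s\<in>{1..n}. if arm policy w s = i then llr a b (Xs w s) (rew w i s) else 0)"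
  unfolding lam_def Lam_def by (intro sum.cong) (auto simp: Ys_def)

lemma stats_past:
  assumes "n < t"
  shows "plls i n (w(t := z)) = plls i n w" "lam i a b n (w(t := z)) = lam i a b n w"
    "gd i n \<theta> (w(t := z)) = gd i n \<theta> w"
proof -
  have A: "arm policy (w(t := z)) s = arm policy w s" if "s \<in> {1..n}" for s
    using that assms by (simp add: arm_past)
  have lam: "lam i a b n (w(t := z)) = lam i a b n w" for a b
    unfolding lam_def by (intro Lam_cong) (use assms A in \<open>auto simp: Xs_upd Ys_def rew_eq\<close>)
  then show "lam i a b n (w(t := z)) = lam i a b n w" .
  show "gd i n \<theta> (w(t := z)) = gd i n \<theta> w"
    unfolding gd_def good_def lam[unfolded lam_def] ..
  show "plls i n (w(t := z)) = plls i n w"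
    unfolding plls_def using A by (rule pulls_cong)
qed

text \<open>The likelihood ratio of a false parameter against the truth has conditional mean one at
  each pull. Uniformity in n matters because the test is applied at a random sample size.\<close>

lemma prob_lam_ge_le_exp:
  assumes "a \<in> \<Theta>" "a \<noteq> par C i"
  shows "P.prob {w\<in>space \<P>. \<exists>n. c \<le> lam i a (par C i) n w} \<le> exp (- c)"
  unfolding lam_eq
proof (rule prob_ex_arm_sum_ge_le_exp)
  fix x assume x: "x \<in> set_pmf G"
  show "llr a (par C i) x \<in> borel_measurable borel"
    using assms par_in by (intro measurable_llr_y)
  interpret Q: prob_space "F a x" using assms x by (intro prob_family)
  have "(\<integral>\<^sup>+y. 1 * ennreal (exp (llr a (par C i) x y)) \<partial>F (par C i) x) = (\<integral>\<^sup>+y. 1 \<partial>F a x)"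
    using assms par_in x by (intro nn_integral_exp_llr) auto
  then show "(\<integral>\<^sup>+y. ennreal (exp (llr a (par C i) x y)) \<partial>F (par C i) x) \<le> 1"
    by (simp add: Q.emeasure_space_1)
qed

text \<open>Chernoff bound from below: along the pulls of arm \<open>i\<close> the log-likelihood ratio of the true
  parameter against \<open>b\<close> grows at every rate below the Kullback--Leibler number.\<close>
lemma ex_prob_drift_deficit_le_exp:
  assumes b: "b \<in> \<Theta>" "b \<noteq> par C i"
    and \<kappa>: "\<And>x. x \<in> set_pmf G \<Longrightarrow> \<kappa> x < KLnum (F (par C i) x) (F b x)"
  obtains s :: real where "0 < s" "\<And>c. P.prob {w\<in>space \<P>. \<exists>n.
      c \<le> (\<Sum>s\<in>{1..n}. if arm policy w s = i then \<kappa> (Xs w s) else 0) - lam i (par C i) b n w} \<le> exp (- s * c)"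
proof -
  obtain s :: real where s: "0 < s"
    and le: "\<And>x. x \<in> set_pmf G \<Longrightarrow> (\<integral>\<^sup>+y. ennreal (exp (- s * (llr (par C i) b x y - \<kappa> x))) \<partial>F (par C i) x) \<le> 1"
    using ex_nn_integral_exp_llr_le_1[OF par_in[of i] b(1) b(2)[symmetric] \<kappa>] by blast
  have "P.prob {w\<in>space \<P>. \<exists>n. c \<le> (\<Sum>s\<in>{1..n}. if arm policy w s = i then \<kappa> (Xs w s) else 0) - lam i (par C i) b n w}
      \<le> exp (- s * c)" for c
  proof -
    have "(\<Sum>k\<in>{1..n}. if arm policy w k = i then - s * (llr (par C i) b (Xs w k) (rew w i k) - \<kappa> (Xs w k)) else 0)
        = s * ((\<Sum>k\<in>{1..n}. if arm policy w k = i then \<kappa> (Xs w k) else 0) - lam i (par C i) b n w)" for n w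
      unfolding lam_eq sum_subtractf[symmetric] sum_distrib_left
      by (intro sum.cong) (auto simp: algebra_simps)
    moreover have "s * c \<le> s * u \<longleftrightarrow> c \<le> u" for u using s by simp
    ultimately show ?thesis
      using prob_ex_arm_sum_ge_le_exp[of "\<lambda>x y. - s * (llr (par C i) b x y - \<kappa> x)" i "s * c", OF _ le]
        measurable_llr_y[OF par_in b(1)] by simp
  qed
  with s show thesis by (rule that)
qed

text \<open>A test that fails after m pulls forces a deficit linear in m, which one maximal
  inequality bounds for all such rounds together. The truth may be the smaller or the larger
  parameter of the fixed ratio; the second case needs a change of measure.\<close>

lemma ex_prob_not_beaten_le_exp:
  assumes \<theta>: "\<theta> \<in> \<Theta>" "\<theta> \<noteq> par C i"
  obtains d :: real where "0 < d"
    "\<And>m. P.prob {w\<in>space \<P>. \<exists>n. plls i n w = m \<and> \<not> beaten i \<theta> n w}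
      \<le> exp (- d * real m)"
proof (cases "par C i < \<theta>")
  case True
  obtain \<kappa> where \<kappa>: "0 < \<kappa>" "\<And>x. x \<in> set_pmf G \<Longrightarrow> \<kappa> < KLnum (F (par C i) x) (F \<theta> x)"
    using ex_KL_lower_bound[OF par_in[of i] \<theta>(1) \<theta>(2)[symmetric]] by blast
  obtain s where s: "0 < s" "\<And>c. P.prob {w\<in>space \<P>. \<exists>n.
      c \<le> (\<Sum>s\<in>{1..n}. if arm policy w s = i then \<kappa> else 0) - lam i (par C i) \<theta> n w} \<le> exp (- s * c)"
    by (rule ex_prob_drift_deficit_le_exp[OF \<theta>, where \<kappa>="\<lambda>_. \<kappa>"]) (use \<kappa>(2) in auto)
  have cnt: "(\<Sum>s\<in>{1..n}. if arm policy w s = i then \<kappa> else 0) = \<kappa> * real (plls i n w)" for n w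
    unfolding plls_def pulls_def by (simp add: sum_distrib_left if_distrib cong: if_cong)
  show thesis
  proof (rule that[of "s * \<kappa>"])
    show "0 < s * \<kappa>" using s \<kappa> by simp
    fix m
    have "P.prob {w\<in>space \<P>. \<exists>n. plls i n w = m \<and> \<not> beaten i \<theta> n w}
      \<le> P.prob {w\<in>space \<P>. \<exists>n. \<kappa> * real m \<le> \<kappa> * real (plls i n w) - lam i (par C i) \<theta> n w}"
    proof (rule P.finite_measure_mono)
      show "{w\<in>space \<P>. \<exists>n. \<kappa> * real m \<le> \<kappa> * real (plls i n w) - lam i (par C i) \<theta> n w} \<in> P.events"
        using \<theta>(1) par_in[of i] by measurable
      show "{w\<in>space \<P>. \<exists>n. plls i n w = m \<and> \<not> beaten i \<theta> n w}
        \<subseteq> {w\<in>space \<P>. \<exists>n. \<kappa> * real m \<le> \<kappa> * real (plls i n w) - lam i (par C i) \<theta> n w}"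
      proof safe
        fix w n assume "\<not> beaten i \<theta> n w"
        then show "\<exists>k. \<kappa> * real (plls i n w) \<le> \<kappa> * real (plls i k w) - lam i (par C i) \<theta> k w"
          using True by (intro exI[of _ n]) (simp add: beaten_def)
      qed
    qed
    also have "\<dots> \<le> exp (- s * (\<kappa> * real m))"
      using s(2)[of "\<kappa> * real m"] by (simp only: cnt)
    finally show "P.prob {w\<in>space \<P>. \<exists>n. plls i n w = m \<and> \<not> beaten i \<theta> n w}
      \<le> exp (- (s * \<kappa>) * real m)" by (simp add: mult.assoc)
  qed
next
  case False
  obtain \<kappa> where \<kappa>: "0 < \<kappa>" "\<And>x. x \<in> set_pmf G \<Longrightarrow> \<kappa> < KLnum (F \<theta> x) (F (par C i) x)"
    using ex_KL_lower_bound[OF \<theta>(1) par_in[of i] \<theta>(2)] by blast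
  obtain s where s: "0 < s" "s \<le> 1"
    and le: "\<And>x. x \<in> set_pmf G \<Longrightarrow> (\<integral>\<^sup>+y. ennreal (exp (- s * (llr \<theta> (par C i) x y - \<kappa>))) \<partial>F \<theta> x) \<le> 1"
    by (rule ex_nn_integral_exp_llr_le_1[OF \<theta>(1) par_in[of i] \<theta>(2), of "\<lambda>_. \<kappa>"]) (use \<kappa>(2) in auto)
  \<comment> \<open>The weight \<open>exp (llr \<theta> (par C i) x y)\<close> turns the true law
    into that of \<theta>. Taken out of \<open>exp (?h x y)\<close>, it leaves the factor
    \<open>exp (- s * (llr \<theta> (par C i) x y - \<kappa>))\<close>, whose mean is bounded under
    \<theta>. The bound s \<le> 1 keeps \<open>(1 - s) * lam\<close> nonnegative when the test
    fails.\<close>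
  let ?h = "\<lambda>x y. (1 - s) * llr \<theta> (par C i) x y + s * \<kappa>"
  have mh [measurable]: "?h x \<in> borel_measurable borel" for x
    using measurable_llr_y[OF \<theta>(1) par_in[of i], of x] by measurable
  have int: "(\<integral>\<^sup>+y. ennreal (exp (?h x y)) \<partial>F (par C i) x) \<le> 1" if x: "x \<in> set_pmf G" for x
  proof -
    have [measurable]: "llr \<theta> (par C i) x \<in> borel_measurable borel"
      by (rule measurable_llr_y[OF \<theta>(1) par_in])
    have "(\<integral>\<^sup>+y. ennreal (exp (?h x y)) \<partial>F (par C i) x)
        = (\<integral>\<^sup>+y. ennreal (exp (- s * (llr \<theta> (par C i) x y - \<kappa>))) * ennreal (exp (llr \<theta> (par C i) x y)) \<partial>F (par C i) x)"
      by (intro nn_integral_cong) (simp add: ennreal_mult[symmetric] exp_add[symmetric] algebra_simps)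
    also have "\<dots> = (\<integral>\<^sup>+y. ennreal (exp (- s * (llr \<theta> (par C i) x y - \<kappa>))) \<partial>F \<theta> x)"
      by (rule nn_integral_exp_llr[OF \<theta>(1) par_in \<theta>(2) x]) measurable
    finally show ?thesis using le[OF x] by simp
  qed
  have sum: "(\<Sum>k\<in>{1..n}. if arm policy w k = i then ?h (Xs w k) (rew w i k) else 0)
      = (1 - s) * lam i \<theta> (par C i) n w + s * \<kappa> * real (plls i n w)" for n w
    unfolding lam_eq plls_def pulls_def of_nat_sum sum_distrib_left sum.distrib[symmetric]
    by (intro sum.cong) auto
  show thesis
  proof (rule that[of "s * \<kappa>"])
    show "0 < s * \<kappa>" using s \<kappa> by simp
    fix m
    have "P.prob {w\<in>space \<P>. \<exists>n. plls i n w = m \<and> \<not> beaten i \<theta> n w}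
      \<le> P.prob {w\<in>space \<P>. \<exists>n. s * \<kappa> * real m \<le> (1 - s) * lam i \<theta> (par C i) n w + s * \<kappa> * real (plls i n w)}"
    proof (rule P.finite_measure_mono)
      show "{w\<in>space \<P>. \<exists>n. s * \<kappa> * real m \<le> (1 - s) * lam i \<theta> (par C i) n w + s * \<kappa> * real (plls i n w)} \<in> P.events"
        using \<theta>(1) par_in[of i] by measurable
      show "{w\<in>space \<P>. \<exists>n. plls i n w = m \<and> \<not> beaten i \<theta> n w}
        \<subseteq> {w\<in>space \<P>. \<exists>n. s * \<kappa> * real m \<le> (1 - s) * lam i \<theta> (par C i) n w + s * \<kappa> * real (plls i n w)}"
      proof safe
        fix w n assume "\<not> beaten i \<theta> n w"
        then show "\<exists>k. s * \<kappa> * real (plls i n w) \<le> (1 - s) * lam i \<theta> (par C i) k w + s * \<kappa> * real (plls i k w)"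
          using False s by (intro exI[of _ n]) (simp add: beaten_def)
      qed
    qed
    also have "\<dots> \<le> exp (- (s * \<kappa> * real m))"
      using prob_ex_arm_sum_ge_le_exp[of ?h i "s * \<kappa> * real m", OF mh int] by (simp only: sum)
    finally show "P.prob {w\<in>space \<P>. \<exists>n. plls i n w = m \<and> \<not> beaten i \<theta> n w}
      \<le> exp (- (s * \<kappa>) * real m)" by (simp add: mult.assoc)
  qed
qed

section \<open>Counting pulls\<close>

text \<open>Indexed by sample size: a single event covers every round at which arm i has m pulls,
  however long that phase lasts.\<close>

definition "Bad i m = {w\<in>space \<P>. \<exists>n. plls i n w = m \<and> \<not> gd i n (par C i) w}"

lemma sets_Bad [measurable]: "Bad i m \<in> sets \<P>"
  unfolding Bad_def using par_in[of i] by measurable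

lemma summable_Bad: "summable (\<lambda>m. real (Suc m) * P.prob (Bad i m))"
proof -
  let ?B = "\<lambda>m \<theta>. {w\<in>space \<P>. \<exists>n. plls i n w = m \<and> \<not> beaten i \<theta> n w}"
  have "\<exists>d>0. \<forall>m. P.prob (?B m \<theta>) \<le> exp (- d * real m)" if \<theta>: "\<theta> \<in> \<Theta> - {par C i}" for \<theta>
  proof (rule ex_prob_not_beaten_le_exp[of \<theta> i])
    show "\<theta> \<in> \<Theta>" "\<theta> \<noteq> par C i" using \<theta> by auto
    fix d :: real assume "0 < d" "\<And>m. P.prob (?B m \<theta>) \<le> exp (- d * real m)"
    then show ?thesis by blast
  qed
  then have "\<forall>\<theta>\<in>\<Theta> - {par C i}. \<exists>d. 0 < d \<and> (\<forall>m. P.prob (?B m \<theta>) \<le> exp (- d * real m))"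
    by blast
  from bchoice[OF this] obtain d
    where "\<forall>\<theta>\<in>\<Theta> - {par C i}. 0 < d \<theta> \<and> (\<forall>m. P.prob (?B m \<theta>) \<le> exp (- d \<theta> * real m))" ..
  then have d: "\<And>\<theta>. \<theta> \<in> \<Theta> - {par C i} \<Longrightarrow> 0 < d \<theta>"
    "\<And>\<theta> m. \<theta> \<in> \<Theta> - {par C i} \<Longrightarrow> P.prob (?B m \<theta>) \<le> exp (- d \<theta> * real m)"
    by blast+
  have le: "P.prob (Bad i m) \<le> (\<Sum>\<theta>\<in>\<Theta> - {par C i}. exp (- d \<theta> * real m))" for m
  proof -
    have [measurable]: "?B m \<theta> \<in> sets \<P>" if "\<theta> \<in> \<Theta>" for \<theta>
      using that by measurable
    have "Bad i m \<subseteq> (\<Union>\<theta>\<in>\<Theta> - {par C i}. ?B m \<theta>)"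
      unfolding Bad_def gd_par_iff by auto
    then have "P.prob (Bad i m) \<le> P.prob (\<Union>\<theta>\<in>\<Theta> - {par C i}. ?B m \<theta>)"
      using finite_\<Theta> by (intro P.finite_measure_mono sets.finite_UN) auto
    also have "\<dots> \<le> (\<Sum>\<theta>\<in>\<Theta> - {par C i}. P.prob (?B m \<theta>))"
      using finite_\<Theta> by (intro P.finite_measure_subadditive_finite) auto
    also have "\<dots> \<le> (\<Sum>\<theta>\<in>\<Theta> - {par C i}. exp (- d \<theta> * real m))"
      by (intro sum_mono d(2))
    finally show ?thesis .
  qed
  show ?thesis
  proof (rule summable_comparison_test')
    show "summable (\<lambda>m. \<Sum>\<theta>\<in>\<Theta> - {par C i}. real (Suc m) * exp (- d \<theta> * real m))"
      by (intro summable_sum summable_Suc_mult_exp d(1))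
    show "norm (real (Suc m) * P.prob (Bad i m)) \<le> (\<Sum>\<theta>\<in>\<Theta> - {par C i}. real (Suc m) * exp (- d \<theta> * real m))" for m
      unfolding sum_distrib_left[symmetric] using le[of m]
      by (auto simp: abs_mult intro!: mult_left_mono)
  qed
qed

text \<open>Only pulls at the exploration covariate are guaranteed the rate K, so these are counted
  separately from the other pulls of the arm.\<close>

definition "visits i x n w = (\<Sum>s\<in>{1..n}. if arm policy w s = i \<and> Xs w s = x then 1 else (0::nat))"

lemma measurable_visits [measurable]: "visits i x n \<in> \<P> \<rightarrow>\<^sub>M count_space UNIV"
proof -
  note [measurable] = measurable_arm_component measurable_Xs_component
  show ?thesis unfolding visits_def[abs_def] by measurable
qed

definition "Slow j x \<kappa> m = {w\<in>space \<P>. \<exists>n. visits j x n w = m \<and>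
  (\<exists>\<theta>\<in>\<Theta>. par C (3 - j) < \<theta> \<and> lam j (par C j) \<theta> n w \<le> \<kappa> * real m)}"

lemma sets_Slow [measurable]: "Slow j x \<kappa> m \<in> sets \<P>"
proof -
  have "Measurable.pred \<P> (\<lambda>w. \<exists>\<theta>\<in>\<Theta>. par C (3 - j) < \<theta> \<and> lam j (par C j) \<theta> n w \<le> \<kappa> * real m)" for n
    using finite_\<Theta> measurable_lam[OF par_in] by (intro pred_intros_finite pred_intros_logic) auto
  then show ?thesis
    unfolding Slow_def by measurable
qed

lemma summable_Slow:
  assumes j: "par C j < par C (3 - j)"
    and \<kappa>: "\<And>\<theta>. \<theta> \<in> \<Theta> \<Longrightarrow> par C (3 - j) < \<theta> \<Longrightarrow> \<kappa> < KLnum (F (par C j) x) (F \<theta> x)"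
  shows "summable (\<lambda>m. P.prob (Slow j x \<kappa> m))"
proof -
  let ?T = "{\<theta>\<in>\<Theta>. par C (3 - j) < \<theta>}"
  let ?B = "\<lambda>m \<theta>. {w\<in>space \<P>. \<exists>n. visits j x n w = m \<and> lam j (par C j) \<theta> n w \<le> \<kappa> * real m}"
  have ex: "\<exists>d>0. \<forall>m. P.prob (?B m \<theta>) \<le> exp (- d * real m)" if \<theta>: "\<theta> \<in> ?T" for \<theta>
  proof -
    have \<theta>': "\<theta> \<in> \<Theta>" using \<theta> by simp
    obtain \<kappa>' where \<kappa>': "\<kappa> < \<kappa>'" "\<kappa>' < KLnum (F (par C j) x) (F \<theta> x)"
      using dense[OF \<kappa>[of \<theta>]] \<theta> by auto
    \<comment> \<open>Pulls at other covariates also have positive drift, so crediting them with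
      rate 0 is safe. The gap between \<kappa> and \<kappa>' gives a deficit proportional to the
      number of visits.\<close>
    let ?\<kappa> = "\<lambda>x'. if x' = x then \<kappa>' else 0"
    obtain s where s: "0 < s" "\<And>c. P.prob {w\<in>space \<P>. \<exists>n.
      c \<le> (\<Sum>s\<in>{1..n}. if arm policy w s = j then ?\<kappa> (Xs w s) else 0) - lam j (par C j) \<theta> n w} \<le> exp (- s * c)"
    proof (rule ex_prob_drift_deficit_le_exp[where \<kappa>="?\<kappa>" and i=j and b=\<theta>])
      show "\<theta> \<in> \<Theta>" "\<theta> \<noteq> par C j" using \<theta> j by auto
      show "?\<kappa> x' < KLnum (F (par C j) x') (F \<theta> x')" if "x' \<in> set_pmf G" for x'
        using \<kappa>'(2) KL_pos[of "par C j" \<theta> x'] that \<theta> j par_in[of j] by auto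
    qed blast
    have cnt: "(\<Sum>s\<in>{1..n}. if arm policy w s = j then ?\<kappa> (Xs w s) else 0) = \<kappa>' * real (visits j x n w)" for n w
      unfolding visits_def of_nat_sum sum_distrib_left by (intro sum.cong) auto
    have "P.prob (?B m \<theta>) \<le> exp (- (s * (\<kappa>' - \<kappa>)) * real m)" for m
    proof -
      have "P.prob (?B m \<theta>) \<le> P.prob {w\<in>space \<P>. \<exists>n. (\<kappa>' - \<kappa>) * real m \<le> \<kappa>' * real (visits j x n w) - lam j (par C j) \<theta> n w}"
      proof (rule P.finite_measure_mono)
        show "{w\<in>space \<P>. \<exists>n. (\<kappa>' - \<kappa>) * real m \<le> \<kappa>' * real (visits j x n w) - lam j (par C j) \<theta> n w} \<in> P.events"
          using \<theta>' par_in[of j] by measurable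
        show "?B m \<theta> \<subseteq> {w\<in>space \<P>. \<exists>n. (\<kappa>' - \<kappa>) * real m \<le> \<kappa>' * real (visits j x n w) - lam j (par C j) \<theta> n w}"
        proof safe
          fix w n assume "lam j (par C j) \<theta> n w \<le> \<kappa> * real (visits j x n w)"
          then show "\<exists>k. (\<kappa>' - \<kappa>) * real (visits j x n w) \<le> \<kappa>' * real (visits j x k w) - lam j (par C j) \<theta> k w"
            by (intro exI[of _ n]) (simp add: algebra_simps)
        qed
      qed
      also have "\<dots> \<le> exp (- s * ((\<kappa>' - \<kappa>) * real m))"
        using s(2)[of "(\<kappa>' - \<kappa>) * real m"] by (simp only: cnt)
      finally show ?thesis by (simp add: mult.assoc)
    qed
    moreover have "0 < s * (\<kappa>' - \<kappa>)" using s \<kappa>' by simp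
    ultimately show ?thesis by blast
  qed
  then have "\<forall>\<theta>\<in>?T. \<exists>d. 0 < d \<and> (\<forall>m. P.prob (?B m \<theta>) \<le> exp (- d * real m))"
    by blast
  from bchoice[OF this] obtain d
    where "\<forall>\<theta>\<in>?T. 0 < d \<theta> \<and> (\<forall>m. P.prob (?B m \<theta>) \<le> exp (- d \<theta> * real m))" ..
  then have d: "\<And>\<theta>. \<theta> \<in> ?T \<Longrightarrow> 0 < d \<theta>"
    "\<And>\<theta> m. \<theta> \<in> ?T \<Longrightarrow> P.prob (?B m \<theta>) \<le> exp (- d \<theta> * real m)"
    by blast+
  have le: "P.prob (Slow j x \<kappa> m) \<le> (\<Sum>\<theta>\<in>?T. exp (- d \<theta> * real m))" for m
  proof -
    have [measurable]: "?B m \<theta> \<in> sets \<P>" if "\<theta> \<in> \<Theta>" for \<theta>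
      using that par_in[of j] by measurable
    have "Slow j x \<kappa> m \<subseteq> (\<Union>\<theta>\<in>?T. ?B m \<theta>)"
      unfolding Slow_def by auto
    then have "P.prob (Slow j x \<kappa> m) \<le> P.prob (\<Union>\<theta>\<in>?T. ?B m \<theta>)"
      using finite_\<Theta> by (intro P.finite_measure_mono sets.finite_UN) auto
    also have "\<dots> \<le> (\<Sum>\<theta>\<in>?T. P.prob (?B m \<theta>))"
      using finite_\<Theta> by (intro P.finite_measure_subadditive_finite) auto
    also have "\<dots> \<le> (\<Sum>\<theta>\<in>?T. exp (- d \<theta> * real m))"
      by (intro sum_mono d(2))
    finally show ?thesis .
  qed
  show ?thesis
  proof (rule summable_comparison_test')
    show "summable (\<lambda>m. \<Sum>\<theta>\<in>?T. real (Suc m) * exp (- d \<theta> * real m))"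
      by (intro summable_sum summable_Suc_mult_exp d(1))
    fix m
    have "P.prob (Slow j x \<kappa> m) \<le> real (Suc m) * P.prob (Slow j x \<kappa> m)"
      by (simp add: algebra_simps)
    also have "\<dots> \<le> real (Suc m) * (\<Sum>\<theta>\<in>?T. exp (- d \<theta> * real m))"
      using le[of m] by (intro mult_left_mono) auto
    finally show "norm (P.prob (Slow j x \<kappa> m)) \<le> (\<Sum>\<theta>\<in>?T. real (Suc m) * exp (- d \<theta> * real m))"
      by (simp add: sum_distrib_left)
  qed
qed

lemma mono_plls: "mono (\<lambda>n. plls i n w)"
  by (intro incseq_SucI) (simp add: plls_def pulls_Suc)

lemma plls_le: "plls i n w \<le> n"
  by (induction n) (auto simp: plls_def pulls_Suc, simp add: pulls_def)

lemma plls_step: "1 \<le> t \<Longrightarrow> arm policy w t = i \<Longrightarrow> plls i (t - 1) w < plls i t w"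
  by (cases t) (auto simp: plls_def pulls_Suc)

lemma visits_Suc: "visits i x (Suc n) w = visits i x n w + (if arm policy w (Suc n) = i \<and> Xs w (Suc n) = x then 1 else 0)"
  by (simp add: visits_def)

lemma mono_visits: "mono (\<lambda>n. visits i x n w)"
  by (intro incseq_SucI) (simp add: visits_Suc)

lemma visits_le: "visits i x n w \<le> n"
  by (induction n) (auto simp: visits_Suc, simp add: visits_def)

lemma visits_step: "1 \<le> t \<Longrightarrow> arm policy w t = i \<Longrightarrow> Xs w t = x \<Longrightarrow> visits i x (t - 1) w < visits i x t w"
  by (cases t) (auto simp: visits_Suc)

lemma card_wrong_le:
  assumes "w \<in> space \<P>"
  shows "real (card {t\<in>{1..T}. arm policy w t = i \<and> \<not> gd i (t - 1) (par C i) w})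
    \<le> (\<Sum>m<T. indicator (Bad i m) w)"
proof -
  have "card {t\<in>{1..T}. arm policy w t = i \<and> \<not> gd i (t - 1) (par C i) w} \<le> (\<Sum>m<T. of_bool (w \<in> Bad i m))"
    by (rule card_le_sum_counter[where c="\<lambda>n. plls i n w"])
       (use assms in \<open>auto simp: mono_plls plls_le plls_step[simplified] Bad_def\<close>)
  then have "real (card {t\<in>{1..T}. arm policy w t = i \<and> \<not> gd i (t - 1) (par C i) w}) \<le> real (\<Sum>m<T. of_bool (w \<in> Bad i m))"
    by (rule of_nat_mono)
  also have "\<dots> = (\<Sum>m<T. indicator (Bad i m) w)"
    unfolding of_nat_sum by (intro sum.cong) (auto simp: indicator_def of_bool_def)
  finally show ?thesis .
qed

lemma card_behind_le:
  assumes "w \<in> space \<P>"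
  shows "real (card {t\<in>{1..T}. arm policy w t = j \<and> plls j (t - 1) w \<le> plls l (t - 1) w \<and> \<not> gd l (t - 1) (par C l) w})
    \<le> (\<Sum>m<T. real (Suc m) * indicator (Bad l m) w)" (is "real (card ?D) \<le> _")
proof -
  have "card ?D \<le> (\<Sum>m<T. Suc m * of_bool (w \<in> Bad l m))"
    by (rule card_le_sum_two_counters[where c="\<lambda>n. plls j n w" and d="\<lambda>n. plls l n w"])
       (use assms in \<open>auto simp: mono_plls plls_le plls_step[simplified] Bad_def\<close>)
  then have "real (card ?D) \<le> real (\<Sum>m<T. Suc m * of_bool (w \<in> Bad l m))"
    by (rule of_nat_mono)
  also have "\<dots> = (\<Sum>m<T. real (Suc m) * indicator (Bad l m) w)"
    unfolding of_nat_sum by (intro sum.cong) (auto simp: indicator_def of_bool_def)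
  finally show ?thesis .
qed

lemma level_mono: "1 \<le> s \<Longrightarrow> s \<le> t \<Longrightarrow> level s \<le> level t"
proof -
  assume "1 \<le> s" "s \<le> t"
  then have "ln (real s) \<le> ln (real t)" "0 \<le> ln (real s)" by auto
  then show ?thesis
    unfolding level_def by (intro add_mono mult_left_mono) (auto simp: add_pos_nonneg)
qed

lemma level_nonneg: "1 \<le> t \<Longrightarrow> 0 \<le> level t"
  using level_mono[of 1 t] by (simp add: level_def)

text \<open>The source of the logarithm: if a parameter is still not rejected after m visits, either
  m < \<open>level T / \<kappa>\<close>, or the statistic has grown more slowly than \<kappa> per
  visit. The summand 1 comes from rounding up.\<close>

lemma card_explore_le:
  assumes w: "w \<in> space \<P>" and \<kappa>: "0 < \<kappa>" and T: "1 \<le> T"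
  shows "real (card {t\<in>{1..T}. arm policy w t = j \<and> Xs w t = x \<and>
      (\<exists>\<theta>\<in>\<Theta>. par C (3 - j) < \<theta> \<and> lam j (par C j) \<theta> (t - 1) w < level t)})
    \<le> level T / \<kappa> + 1 + (\<Sum>m<T. indicator (Slow j x \<kappa> m) w)" (is "real (card ?D) \<le> _")
proof -
  let ?B = "\<lambda>m. real m < level T / \<kappa> \<or> w \<in> Slow j x \<kappa> m"
  have "card ?D \<le> (\<Sum>m<T. of_bool (?B m))"
  proof (rule card_le_sum_counter[where c="\<lambda>n. visits j x n w"])
    fix t assume t: "t \<in> ?D"
    then obtain \<theta> where \<theta>: "\<theta> \<in> \<Theta>" "par C (3 - j) < \<theta>" "lam j (par C j) \<theta> (t - 1) w < level t" by auto
    have "level t \<le> level T" using t by (intro level_mono) auto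
    show "?B (visits j x (t - 1) w)"
    proof (cases "real (visits j x (t - 1) w) < level T / \<kappa>")
      case False
      then have "level T \<le> \<kappa> * real (visits j x (t - 1) w)"
        using \<kappa> by (simp add: field_simps)
      then have "lam j (par C j) \<theta> (t - 1) w \<le> \<kappa> * real (visits j x (t - 1) w)"
        using \<theta>(3) \<open>level t \<le> level T\<close> by linarith
      then show ?thesis
        using w \<theta> unfolding Slow_def by auto
    qed simp
  qed (auto simp: mono_visits visits_le visits_step[simplified])
  then have "real (card ?D) \<le> real (\<Sum>m<T. of_bool (?B m))"
    by (rule of_nat_mono)
  also have "\<dots> \<le> (\<Sum>m<T. of_bool (real m < level T / \<kappa>) + indicator (Slow j x \<kappa> m) w)"
    unfolding of_nat_sum by (intro sum_mono) (auto simp: indicator_def)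
  also have "\<dots> = real (card {m\<in>{..<T}. real m < level T / \<kappa>}) + (\<Sum>m<T. indicator (Slow j x \<kappa> m) w)"
    by (simp add: sum.distrib of_bool_def sum.If_cases Int_def)
  also have "real (card {m\<in>{..<T}. real m < level T / \<kappa>}) \<le> level T / \<kappa> + 1"
  proof -
    have nn: "0 \<le> level T / \<kappa>" using level_nonneg[OF T] \<kappa> by simp
    have "{m\<in>{..<T}. real m < level T / \<kappa>} \<subseteq> {..<nat \<lceil>level T / \<kappa>\<rceil>}"
      by (auto simp: zless_nat_eq_int_zless less_ceiling_iff)
    then have "card {m\<in>{..<T}. real m < level T / \<kappa>} \<le> nat \<lceil>level T / \<kappa>\<rceil>"
      using card_mono[of "{..<nat \<lceil>level T / \<kappa>\<rceil>}"] by fastforce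
    then have "real (card {m\<in>{..<T}. real m < level T / \<kappa>}) \<le> real (nat \<lceil>level T / \<kappa>\<rceil>)"
      by (rule of_nat_mono)
    also have "\<dots> \<le> level T / \<kappa> + 1"
      using nn by linarith
    finally show ?thesis .
  qed
  finally show ?thesis by simp
qed

lemma summable_prob_Bad: "summable (\<lambda>m. P.prob (Bad i m))"
  by (rule summable_comparison_test'[OF summable_Bad[of i]]) (simp add: algebra_simps)

lemma expectation_sum_indicator:
  assumes "finite I" "\<And>m. m \<in> I \<Longrightarrow> B m \<in> sets \<P>"
  shows "integrable \<P> (\<lambda>w. \<Sum>m\<in>I. c m * indicator (B m) w :: real)"
    "P.expectation (\<lambda>w. \<Sum>m\<in>I. c m * indicator (B m) w :: real) = (\<Sum>m\<in>I. c m * P.prob (B m))"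
proof -
  have i: "integrable \<P> (\<lambda>w. c m * indicator (B m) w :: real)" if "m \<in> I" for m
    using assms that by (intro integrable_mult_right integrable_real_indicator) (auto simp: less_top[symmetric])
  then show "integrable \<P> (\<lambda>w. \<Sum>m\<in>I. c m * indicator (B m) w :: real)"
    by (intro Bochner_Integration.integrable_sum) auto
  have "B m \<inter> space \<P> = B m" if "m \<in> I" for m
    using sets.sets_into_space[OF assms(2)[OF that]] by auto
  then show "P.expectation (\<lambda>w. \<Sum>m\<in>I. c m * indicator (B m) w :: real) = (\<Sum>m\<in>I. c m * P.prob (B m))"
    using i by (subst Bochner_Integration.integral_sum) (auto intro!: sum.cong)
qed

definition "Rejected l a t = {w\<in>space \<P>. level t \<le> lam l a (par C l) (t - 1) w}"

text \<open>Refers to the first t - 1 rounds only; the covariate of round t is left out so that it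
  is independent of this event.\<close>

definition "misled_at j a t w \<longleftrightarrow> gd (3 - j) (t - 1) a w \<and> gd j (t - 1) (par C j) w \<and>
  plls (3 - j) (t - 1) w < plls j (t - 1) w \<and>
  (\<exists>\<theta>\<in>\<Theta>. par C j < \<theta> \<and> lam (3 - j) a \<theta> (t - 1) w < level t)"

definition "Misled j a t = {w\<in>space \<P>. misled_at j a t w}"

lemma sets_Rejected: "a \<in> \<Theta> \<Longrightarrow> Rejected l a t \<in> sets \<P>"
  unfolding Rejected_def using measurable_lam[OF _ par_in[of l]] by measurable

lemma measurable_misled_at: "a \<in> \<Theta> \<Longrightarrow> Measurable.pred \<P> (misled_at j a t)"
proof -
  assume a: "a \<in> \<Theta>"
  have "Measurable.pred \<P> (\<lambda>w. \<exists>\<theta>\<in>\<Theta>. par C j < \<theta> \<and> lam (3 - j) a \<theta> (t - 1) w < level t)"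
    using finite_\<Theta> measurable_lam[OF a] by (intro pred_intros_finite pred_intros_logic) auto
  then show ?thesis
    unfolding misled_at_def[abs_def]
    using measurable_gd[OF a] measurable_gd[OF par_in[of j]] by measurable
qed

lemma sets_Misled: "a \<in> \<Theta> \<Longrightarrow> Misled j a t \<in> sets \<P>"
  unfolding Misled_def using measurable_misled_at[of a j t] by measurable

lemma prob_Rejected_le:
  assumes "a \<in> \<Theta>" "a \<noteq> par C l"
  shows "P.prob (Rejected l a t) \<le> exp (- level t)"
proof -
  have "P.prob (Rejected l a t) \<le> P.prob {w\<in>space \<P>. \<exists>n. level t \<le> lam l a (par C l) n w}"
  proof (rule P.finite_measure_mono)
    show "{w\<in>space \<P>. \<exists>n. level t \<le> lam l a (par C l) n w} \<in> sets \<P>"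
      using assms(1) par_in[of l] by measurable
  qed (auto simp: Rejected_def)
  also have "\<dots> \<le> exp (- level t)"
    by (rule prob_lam_ge_le_exp[OF assms])
  finally show ?thesis .
qed

lemma arm_policy_decide:
  assumes "1 \<le> t"
  shows "arm policy w t = decide (arm policy w) (Xs w) (Ys w) (t - 1)"
  using arm_policy_Suc[of w "t - 1"] assms by simp

text \<open>Whenever the rule is misled it pulls the superior arm with probability at least
  \<open>pmf G (xst a (par C j))\<close>, independently of the past, and such pulls are few.\<close>
lemma sum_prob_Misled_le:
  assumes j: "j \<in> {1, 2}" "par C j < par C (3 - j)" and a: "a \<in> \<Theta>" "a < par C j"
  shows "(\<Sum>t\<in>{1..T}. P.prob (Misled j a t)) \<le> (\<Sum>m<T. P.prob (Bad (3 - j) m)) / pmf G (xst a (par C j))"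
proof -
  let ?x = "xst a (par C j)" and ?l = "3 - j"
  note [measurable] = measurable_Xs_component
  define B where "B t = {w\<in>space \<P>. misled_at j a t w \<and> Xs w t = ?x}" for t
  have setsB: "B t \<in> sets \<P>" for t
    unfolding B_def using measurable_misled_at[OF a(1), of j t] by measurable
  have p: "0 < pmf G ?x"
    using xst[OF a(1) par_in[of j]] by (simp add: pmf_positive)
  have "P.prob (B t) = pmf G ?x * P.prob (Misled j a t)" if "1 \<le> t" for t
    unfolding B_def Misled_def
  proof (rule prob_past_and_covariate[OF measurable_misled_at[OF a(1)]])
    have "t - 1 < t" using that by simp
    then show "misled_at j a t (w(t := z)) = misled_at j a t w" for w z
      unfolding misled_at_def by (simp only: stats_past)
  qed
  then have "pmf G ?x * (\<Sum>t\<in>{1..T}. P.prob (Misled j a t)) = (\<Sum>t\<in>{1..T}. 1 * P.prob (B t))"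
    by (simp add: sum_distrib_left)
  also have "\<dots> = P.expectation (\<lambda>w. \<Sum>t\<in>{1..T}. 1 * indicator (B t) w)"
    by (rule expectation_sum_indicator(2)[symmetric]) (auto simp: setsB)
  also have "\<dots> \<le> P.expectation (\<lambda>w. \<Sum>m<T. 1 * indicator (Bad ?l m) w)"
  proof (rule integral_mono)
    fix w assume w: "w \<in> space \<P>"
    have "(\<Sum>t\<in>{1..T}. 1 * indicator (B t) w) = real (card {t\<in>{1..T}. w \<in> B t})"
      by (simp add: indicator_def sum.If_cases Int_def)
    \<comment> \<open>Each of these rounds advances the pull count of the superior arm while its
      estimate is wrong, so \<open>Bad\<close> bounds their number.\<close>
    also have "\<dots> \<le> real (card {t\<in>{1..T}. arm policy w t = ?l \<and> \<not> gd ?l (t - 1) (par C ?l) w})"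
    proof (intro of_nat_mono card_mono subsetI)
      fix t assume t: "t \<in> {t\<in>{1..T}. w \<in> B t}"
      then have t1: "1 \<le> t" "Suc (t - 1) = t" by auto
      have m: "misled_at j a t w" "Xs w t = ?x" using t by (auto simp: B_def)
      then have "undecided (arm policy w) (Xs w) (Ys w) ?l (t - 1) a (par C j)"
        unfolding misled_at_def undecided_def lam_def t1 by auto
      then have "decide (arm policy w) (Xs w) (Ys w) (t - 1) = ?l" "\<not> gd ?l (t - 1) (par C ?l) w"
        using decide_misled[OF j(1) par_in par_in j(2) a, of "arm policy w" "Xs w" "Ys w" "t - 1"] m
        unfolding misled_at_def gd_def plls_def t1 by auto
      then show "t \<in> {t\<in>{1..T}. arm policy w t = ?l \<and> \<not> gd ?l (t - 1) (par C ?l) w}"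
        using t t1 by (simp add: arm_policy_decide)
    qed simp
    also have "\<dots> \<le> (\<Sum>m<T. 1 * indicator (Bad ?l m) w)"
      using card_wrong_le[OF w] by simp
    finally show "(\<Sum>t\<in>{1..T}. 1 * indicator (B t) w) \<le> (\<Sum>m<T. 1 * indicator (Bad ?l m) w :: real)" .
  qed (intro expectation_sum_indicator(1); auto simp: setsB)+
  also have "\<dots> = (\<Sum>m<T. 1 * P.prob (Bad ?l m))"
    by (rule expectation_sum_indicator(2)) auto
  finally show ?thesis
    using p by (simp add: field_simps)
qed

text \<open>Only \<open>level T / \<kappa>\<close> will grow in the mean. The last case of the
  decision is split by whether all parameters above the apparent leader have been rejected for the
  superior arm.\<close>

lemma Tinf_le:
  assumes j: "j \<in> {1, 2}" "par C j < par C (3 - j)"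
    and mean: "\<And>x. x \<in> set_pmf G \<Longrightarrow> mean F (par C j) x < mean F (par C (3 - j)) x"
    and \<kappa>: "0 < \<kappa>" and T: "1 \<le> T" and w: "w \<in> space \<P>" "\<And>t. Xs w t \<in> set_pmf G"
  shows "real (Tinf F policy C w T) \<le>
    (\<Sum>m<T. 1 * indicator (Bad j m) w) + (\<Sum>m<T. real (Suc m) * indicator (Bad (3 - j) m) w)
    + (level T / \<kappa> + 1 + (\<Sum>m<T. 1 * indicator (Slow j (xst (par C j) (par C (3 - j))) \<kappa> m) w))
    + ((\<Sum>a\<in>{a\<in>\<Theta>. a < par C j}. \<Sum>t\<in>{1..T}. 1 * indicator (Rejected (3 - j) a t) w)
      + (\<Sum>a\<in>{a\<in>\<Theta>. a < par C j}. \<Sum>t\<in>{1..T}. 1 * indicator (Misled j a t) w))"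
proof -
  let ?l = "3 - j" and ?x = "xst (par C j) (par C (3 - j))" and ?A = "{a\<in>\<Theta>. a < par C j}"
  let ?D1 = "{t\<in>{1..T}. arm policy w t = j \<and> \<not> gd j (t - 1) (par C j) w}"
  let ?D2 = "{t\<in>{1..T}. arm policy w t = j \<and> plls j (t - 1) w \<le> plls ?l (t - 1) w \<and> \<not> gd ?l (t - 1) (par C ?l) w}"
  let ?D3 = "{t\<in>{1..T}. arm policy w t = j \<and> Xs w t = ?x \<and>
      (\<exists>\<theta>\<in>\<Theta>. par C ?l < \<theta> \<and> lam j (par C j) \<theta> (t - 1) w < level t)}"
  let ?D4 = "\<Union>a\<in>?A. {t\<in>{1..T}. w \<in> Rejected ?l a t}"
  let ?D5 = "\<Union>a\<in>?A. {t\<in>{1..T}. w \<in> Misled j a t}"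
  have sub: "{t\<in>{1..T}. arm policy w t \<notin> best F C (Xs w t)} \<subseteq> ?D1 \<union> ?D2 \<union> ?D3 \<union> (?D4 \<union> ?D5)"
  proof
    fix t assume "t \<in> {t\<in>{1..T}. arm policy w t \<notin> best F C (Xs w t)}"
    then have t: "t \<in> {1..T}" "arm policy w t \<notin> best F C (Xs w t)" by auto
    have t1: "1 \<le> t" "Suc (t - 1) = t" using t by auto
    have "?l \<in> best F C (Xs w t)"
      using mean[OF w(2)[of t]] j(1) unfolding best_def by auto
    then have "arm policy w t = j"
      using t(2) arm_range[of w t] j(1) by auto
    then have dec: "decide (arm policy w) (Xs w) (Ys w) (t - 1) = j"
      using t1 by (simp add: arm_policy_decide)
    show "t \<in> ?D1 \<union> ?D2 \<union> ?D3 \<union> (?D4 \<union> ?D5)"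
    proof (rule decide_inferior_cases[OF dec j(1) par_in par_in j(2)])
      assume "\<not> good (arm policy w) (Xs w) (Ys w) j (t - 1) (par C j)"
      then show ?thesis using t \<open>arm policy w t = j\<close> by (simp add: gd_def)
    next
      assume "pulls (arm policy w) j (t - 1) \<le> pulls (arm policy w) ?l (t - 1)"
        "\<not> good (arm policy w) (Xs w) (Ys w) ?l (t - 1) (par C ?l)"
      then show ?thesis using t \<open>arm policy w t = j\<close> by (simp add: gd_def plls_def)
    next
      assume "Xs w (Suc (t - 1)) = ?x" "undecided (arm policy w) (Xs w) (Ys w) j (t - 1) (par C j) (par C ?l)"
      then have "t \<in> ?D3"
        using t \<open>arm policy w t = j\<close> unfolding undecided_def t1 lam_def by simp
      then show ?thesis by simp
    next
      fix a assume a: "a \<in> \<Theta>" "a < par C j" "good (arm policy w) (Xs w) (Ys w) ?l (t - 1) a"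
        "good (arm policy w) (Xs w) (Ys w) j (t - 1) (par C j)"
        "pulls (arm policy w) ?l (t - 1) < pulls (arm policy w) j (t - 1)"
      show ?thesis
      proof (cases "\<exists>\<theta>\<in>\<Theta>. par C j < \<theta> \<and> lam ?l a \<theta> (t - 1) w < level t")
        case True
        then have "w \<in> Misled j a t"
          using a w(1) unfolding Misled_def misled_at_def gd_def plls_def by simp
        then show ?thesis using a t by blast
      next
        case False
        \<comment> \<open>Everything above \<open>par C j\<close> has been rejected, in particular
          the true parameter of the superior arm.\<close>
        then have "w \<in> Rejected ?l a t"
          using j(2) par_in[of ?l] w(1) unfolding Rejected_def by force
        then show ?thesis using a t by blast
      qed
    qed
  qed
  have fin: "finite ?A" using finite_\<Theta> by simp
  have union: "real (card (\<Union>a\<in>?A. {t\<in>{1..T}. w \<in> B a t})) \<le> (\<Sum>a\<in>?A. \<Sum>t\<in>{1..T}. 1 * indicator (B a t) w)" for B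
  proof -
    have "card (\<Union>a\<in>?A. {t\<in>{1..T}. w \<in> B a t}) \<le> (\<Sum>a\<in>?A. card {t\<in>{1..T}. w \<in> B a t})"
      using fin by (rule card_UN_le)
    then have "real (card (\<Union>a\<in>?A. {t\<in>{1..T}. w \<in> B a t})) \<le> (\<Sum>a\<in>?A. real (card {t\<in>{1..T}. w \<in> B a t}))"
      unfolding of_nat_sum[symmetric] by (rule of_nat_mono)
    also have "\<dots> = (\<Sum>a\<in>?A. \<Sum>t\<in>{1..T}. 1 * indicator (B a t) w)"
      by (intro sum.cong) (auto simp: indicator_def sum.If_cases Int_def)
    finally show ?thesis .
  qed
  have "Tinf F policy C w T \<le> card (?D1 \<union> ?D2 \<union> ?D3 \<union> (?D4 \<union> ?D5))"
    unfolding Tinf_def using sub fin by (intro card_mono) auto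
  also have "\<dots> \<le> card ?D1 + card ?D2 + card ?D3 + (card ?D4 + card ?D5)"
    using card_Un_le[of "?D1 \<union> ?D2 \<union> ?D3" "?D4 \<union> ?D5"] card_Un_le[of "?D1 \<union> ?D2" ?D3]
      card_Un_le[of ?D1 ?D2] card_Un_le[of ?D4 ?D5] by linarith
  finally have "real (Tinf F policy C w T) \<le> real (card ?D1) + real (card ?D2) + real (card ?D3) + (real (card ?D4) + real (card ?D5))"
    by linarith
  also have "\<dots> \<le> (\<Sum>m<T. 1 * indicator (Bad j m) w) + (\<Sum>m<T. real (Suc m) * indicator (Bad ?l m) w)
    + (level T / \<kappa> + 1 + (\<Sum>m<T. 1 * indicator (Slow j ?x \<kappa> m) w))
    + ((\<Sum>a\<in>?A. \<Sum>t\<in>{1..T}. 1 * indicator (Rejected ?l a t) w) + (\<Sum>a\<in>?A. \<Sum>t\<in>{1..T}. 1 * indicator (Misled j a t) w))"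
    unfolding mult_1
    by (intro add_mono card_wrong_le card_behind_le card_explore_le w \<kappa> T union[unfolded mult_1])
  finally show ?thesis .
qed

lemma ETinf_le:
  assumes j: "j \<in> {1, 2}" "par C j < par C (3 - j)"
    and mean: "\<And>x. x \<in> set_pmf G \<Longrightarrow> mean F (par C j) x < mean F (par C (3 - j)) x"
    and \<kappa>: "0 < \<kappa>" "\<And>\<theta>. \<theta> \<in> \<Theta> \<Longrightarrow> par C (3 - j) < \<theta> \<Longrightarrow>
      \<kappa> < KLnum (F (par C j) (xst (par C j) (par C (3 - j)))) (F \<theta> (xst (par C j) (par C (3 - j))))"
  shows "\<exists>c. \<forall>T\<ge>1. ETinf F G policy C T \<le> level T / \<kappa> + c"
proof -
  let ?l = "3 - j" and ?x = "xst (par C j) (par C (3 - j))" and ?A = "{a\<in>\<Theta>. a < par C j}"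
  have fin: "finite ?A" using finite_\<Theta> by simp
  have summ_level: "summable (\<lambda>t. exp (- level t))"
    unfolding level_def by (rule summable_exp_level)
  define c where "c = (\<Sum>m. P.prob (Bad j m)) + (\<Sum>m. real (Suc m) * P.prob (Bad ?l m))
    + (1 + (\<Sum>m. P.prob (Slow j ?x \<kappa> m)))
    + ((\<Sum>a\<in>?A. \<Sum>t. exp (- level t)) + (\<Sum>a\<in>?A. (\<Sum>m. P.prob (Bad ?l m)) / pmf G (xst a (par C j))))"
  have "ETinf F G policy C T \<le> level T / \<kappa> + c" if T: "1 \<le> T" for T
  proof -
    let ?R1 = "\<lambda>w. \<Sum>m<T. 1 * indicator (Bad j m) w :: real"
    let ?R2 = "\<lambda>w. \<Sum>m<T. real (Suc m) * indicator (Bad ?l m) w :: real"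
    let ?R3 = "\<lambda>w. \<Sum>m<T. 1 * indicator (Slow j ?x \<kappa> m) w :: real"
    let ?R4 = "\<lambda>w. \<Sum>a\<in>?A. \<Sum>t\<in>{1..T}. 1 * indicator (Rejected ?l a t) w :: real"
    let ?R5 = "\<lambda>w. \<Sum>a\<in>?A. \<Sum>t\<in>{1..T}. 1 * indicator (Misled j a t) w :: real"
    let ?R = "\<lambda>w. ?R1 w + ?R2 w + (level T / \<kappa> + 1 + ?R3 w) + (?R4 w + ?R5 w)"
    have i1: "integrable \<P> ?R1" and i2: "integrable \<P> ?R2" and i3: "integrable \<P> ?R3"
      by (intro expectation_sum_indicator(1); auto)+
    have i4: "integrable \<P> ?R4" and i5: "integrable \<P> ?R5"
      by (intro Bochner_Integration.integrable_sum expectation_sum_indicator(1); auto simp: sets_Rejected sets_Misled)+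
    have e1: "P.expectation ?R1 = (\<Sum>m<T. 1 * P.prob (Bad j m))"
      and e2: "P.expectation ?R2 = (\<Sum>m<T. real (Suc m) * P.prob (Bad ?l m))"
      and e3: "P.expectation ?R3 = (\<Sum>m<T. 1 * P.prob (Slow j ?x \<kappa> m))"
      by (intro expectation_sum_indicator(2); auto)+
    have e4: "P.expectation ?R4 = (\<Sum>a\<in>?A. \<Sum>t\<in>{1..T}. 1 * P.prob (Rejected ?l a t))"
      by (subst Bochner_Integration.integral_sum)
         (auto simp: sets_Rejected intro!: sum.cong expectation_sum_indicator[where c="\<lambda>_. 1", simplified])
    have e5: "P.expectation ?R5 = (\<Sum>a\<in>?A. \<Sum>t\<in>{1..T}. 1 * P.prob (Misled j a t))"
      by (subst Bochner_Integration.integral_sum)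
         (auto simp: sets_Misled intro!: sum.cong expectation_sum_indicator[where c="\<lambda>_. 1", simplified])
    have iR: "integrable \<P> ?R"
      by (intro Bochner_Integration.integrable_add i1 i2 i3 i4 i5) auto
    have eR: "P.expectation ?R = P.expectation ?R1 + P.expectation ?R2 + (level T / \<kappa> + 1 + P.expectation ?R3)
        + (P.expectation ?R4 + P.expectation ?R5)"
      using i1 i2 i3 i4 i5
      by (simp only: Bochner_Integration.integral_add Bochner_Integration.integrable_add P.integrable_const
          lebesgue_integral_const P.prob_space real_scaleR_def mult_1)
    have "ETinf F G policy C T \<le> P.expectation ?R"
      unfolding ETinf_def
    proof -
      have le: "AE w in \<P>. real (Tinf F policy C w T) \<le> ?R w"
        using AE_Xs AE_space
      proof eventually_elim
        case (elim w)
        show ?case by (rule Tinf_le[OF j mean \<kappa>(1) T]) (use elim in auto)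
      qed
      \<comment> \<open>The comparison of integrals rests on the integrability of the majorant; its
        nonnegativity covers the value 0 that a non-integrable function would receive.\<close>
      then have "AE w in \<P>. 0 \<le> ?R w"
        by eventually_elim (rule order_trans[OF of_nat_0_le_iff])
      with iR le show "(\<integral>w. real (Tinf F policy C w T) \<partial>\<P>) \<le> P.expectation ?R"
        by (rule integral_mono_AE')
    qed
    also have "\<dots> \<le> level T / \<kappa> + c"
    proof -
      have "P.expectation ?R1 \<le> (\<Sum>m. P.prob (Bad j m))"
        unfolding e1 unfolding mult_1 by (intro sum_le_suminf summable_prob_Bad) auto
      moreover have "P.expectation ?R2 \<le> (\<Sum>m. real (Suc m) * P.prob (Bad ?l m))"
        unfolding e2 by (intro sum_le_suminf summable_Bad) auto
      moreover have "P.expectation ?R3 \<le> (\<Sum>m. P.prob (Slow j ?x \<kappa> m))"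
        unfolding e3 unfolding mult_1 using summable_Slow[OF j(2) \<kappa>(2)] by (intro sum_le_suminf) auto
      moreover have "P.expectation ?R4 \<le> (\<Sum>a\<in>?A. \<Sum>t. exp (- level t))"
        unfolding e4 unfolding mult_1
      proof (intro sum_mono)
        fix a assume a: "a \<in> ?A"
        have "(\<Sum>t\<in>{1..T}. P.prob (Rejected ?l a t)) \<le> (\<Sum>t\<in>{1..T}. exp (- level t))"
          using a j(2) by (intro sum_mono prob_Rejected_le) auto
        also have "\<dots> \<le> (\<Sum>t. exp (- level t))"
          by (intro sum_le_suminf summ_level) auto
        finally show "(\<Sum>t\<in>{1..T}. P.prob (Rejected ?l a t)) \<le> (\<Sum>t. exp (- level t))" .
      qed
      moreover have "P.expectation ?R5 \<le> (\<Sum>a\<in>?A. (\<Sum>m. P.prob (Bad ?l m)) / pmf G (xst a (par C j)))"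
        unfolding e5 unfolding mult_1
      proof (intro sum_mono)
        fix a assume a: "a \<in> ?A"
        have "(\<Sum>t\<in>{1..T}. P.prob (Misled j a t)) \<le> (\<Sum>m<T. P.prob (Bad ?l m)) / pmf G (xst a (par C j))"
          using a by (intro sum_prob_Misled_le j) auto
        also have "\<dots> \<le> (\<Sum>m. P.prob (Bad ?l m)) / pmf G (xst a (par C j))"
          by (intro divide_right_mono sum_le_suminf summable_prob_Bad) auto
        finally show "(\<Sum>t\<in>{1..T}. P.prob (Misled j a t)) \<le> (\<Sum>m. P.prob (Bad ?l m)) / pmf G (xst a (par C j))" .
      qed
      ultimately show ?thesis
        unfolding eR c_def by linarith
    qed
    finally show ?thesis .
  qed
  then show ?thesis by blast
qed

lemma ETinf_eq_0: "fst C = snd C \<Longrightarrow> ETinf F G policy C T = 0"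
proof -
  assume eq: "fst C = snd C"
  have "best F C x = {1, 2}" for x
    using eq by (auto simp: best_def par_def)
  then have "Tinf F policy C w T = 0" for w
    unfolding Tinf_def using arm_range[of w] by (simp add: card_eq_0_iff)
  then show ?thesis by (simp add: ETinf_def)
qed

lemma ETinf_nonneg: "0 \<le> ETinf F G policy C T"
  unfolding ETinf_def by simp

end

section \<open>From the logarithmic bound to the asymptotic statements\<close>

lemma limsup_le_inverse:
  fixes E :: "nat \<Rightarrow> real" and K :: ereal
  assumes K: "0 \<le> K"
    and bnd: "\<And>\<kappa>. 0 < \<kappa> \<Longrightarrow> ereal \<kappa> < K \<Longrightarrow>
      \<exists>c. \<forall>T\<ge>1. E T \<le> (ln (real T) + 2 * ln (1 + ln (real T))) / \<kappa> + c"
  shows "limsup (\<lambda>t. ereal (E t / ln (real t))) \<le> inverse K"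
proof (rule ccontr)
  assume "\<not> ?thesis"
  then obtain z where z: "inverse K < ereal z" "ereal z < limsup (\<lambda>t. ereal (E t / ln (real t)))"
    using ereal_dense2[of "inverse K"] by (auto simp: not_le)
  have "0 \<le> inverse K" using K by (rule inverse_ereal_ge0I)
  then have "0 < ereal z" using z(1) by (rule le_less_trans)
  then have z0: "0 < z" by simp
  \<comment> \<open>Any real z above \<open>inverse K\<close> corresponds to the admissible rate
    1/z. For K infinite every rate is admissible and the limit superior is at most 0; for K = 0 no
    such z exists.\<close>
  have "ereal (1 / z) < K"
    using K z(1) z0 by (cases K) (auto simp: field_simps split: if_splits)
  then obtain c where c: "\<And>T. 1 \<le> T \<Longrightarrow> E T \<le> (ln (real T) + 2 * ln (1 + ln (real T))) / (1 / z) + c"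
    using bnd[of "1 / z"] z0 by auto
  have "((\<lambda>t::nat. ((ln (real t) + 2 * ln (1 + ln (real t))) * z + c) / ln (real t)) \<longlongrightarrow> z) at_top"
    using z0 by real_asymp
  then have "limsup (\<lambda>t::nat. ereal (((ln (real t) + 2 * ln (1 + ln (real t))) * z + c) / ln (real t))) = ereal z"
    by (intro lim_imp_Limsup) auto
  moreover have "limsup (\<lambda>t. ereal (E t / ln (real t)))
      \<le> limsup (\<lambda>t::nat. ereal (((ln (real t) + 2 * ln (1 + ln (real t))) * z + c) / ln (real t)))"
  proof (rule Limsup_mono)
    show "\<forall>\<^sub>F t in sequentially. ereal (E t / ln (real t))
        \<le> ereal (((ln (real t) + 2 * ln (1 + ln (real t))) * z + c) / ln (real t))"
      using eventually_ge_at_top[of 1]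
    proof eventually_elim
      case (elim t)
      then show ?case using c[of t] by (auto intro!: divide_right_mono)
    qed
  qed
  ultimately show False using z(2) by simp
qed

lemma ex_maximizer:
  fixes g :: "'a \<Rightarrow> 'b::linorder"
  assumes "finite S" "S \<noteq> {}"
  shows "\<exists>x. x \<in> S \<and> (\<forall>x'\<in>S. g x' \<le> g x)"
proof -
  have "Max (g ` S) \<in> g ` S" using assms by (intro Max_in) auto
  then obtain x where "x \<in> S" "g x = Max (g ` S)" by auto
  then show ?thesis using assms by (intro exI[of _ x]) auto
qed

theorem theorem6:
  fixes \<Theta> :: "real set" and F :: "real \<Rightarrow> real \<Rightarrow> real measure" and G :: "real pmf"
  assumes model: "\<forall>\<theta>\<in>\<Theta>. \<forall>x\<in>set_pmf G. prob_space (F \<theta> x) \<and> sets (F \<theta> x) = sets borel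
                     \<and> integrable (F \<theta> x) (\<lambda>y. y)"
    and hb: "finite (set_pmf G)"
    and hc: "\<forall>\<theta>\<in>\<Theta>. \<forall>\<theta>'\<in>\<Theta>. \<theta> \<noteq> \<theta>' \<longrightarrow>
               (\<forall>x\<in>set_pmf G. KL_finite (F \<theta> x) (F \<theta>' x) \<and> 0 < KLnum (F \<theta> x) (F \<theta>' x))"
    and hd: "\<forall>x\<in>set_pmf G. \<forall>\<theta>\<in>\<Theta>. \<forall>\<theta>'\<in>\<Theta>. \<theta> < \<theta>' \<longrightarrow> mean F \<theta> x < mean F \<theta>' x"
    and he: "finite \<Theta>"
    and hf: "\<forall>\<theta>1\<in>\<Theta>. \<forall>\<theta>2\<in>\<Theta>. \<theta>1 < \<theta>2 \<longrightarrow>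
               (INF \<theta>\<in>{\<theta>\<in>\<Theta>. \<theta>2 < \<theta>}. SUP x\<in>set_pmf G. ereal (KLnum (F \<theta>1 x) (F \<theta> x)))
             = (SUP x\<in>set_pmf G. INF \<theta>\<in>{\<theta>\<in>\<Theta>. \<theta>2 < \<theta>}. ereal (KLnum (F \<theta>1 x) (F \<theta> x)))"
  shows "\<exists>\<phi>. alloc_rule \<phi> \<and> uniformly_good F G \<Theta> \<phi> \<and>
           (\<forall>\<theta>1\<in>\<Theta>. \<forall>\<theta>2\<in>\<Theta>. \<theta>1 \<noteq> \<theta>2 \<longrightarrow>
              limsup (\<lambda>t. ereal (ETinf F G \<phi> (\<theta>1, \<theta>2) t / ln (real t)))
                \<le> inverse (Kc F G \<Theta> (\<theta>1, \<theta>2)))"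
proof -
  define g where "g a b x = (INF \<theta>\<in>{\<theta>\<in>\<Theta>. b < \<theta>}. ereal (KLnum (F a x) (F \<theta> x)))" for a b x
  \<comment> \<open>The rule does not know the configuration, so a maximin covariate is fixed in
    advance for every pair of possible estimates.\<close>
  define xst where "xst a b = (SOME x. x \<in> set_pmf G \<and> (\<forall>x'\<in>set_pmf G. g a b x' \<le> g a b x))" for a b
  have xst_max: "xst a b \<in> set_pmf G \<and> (\<forall>x'\<in>set_pmf G. g a b x' \<le> g a b (xst a b))" for a b
    unfolding xst_def using ex_maximizer[OF hb set_pmf_not_empty] by (rule someI_ex)
  interpret bandit_family \<Theta> F G xst
  proof (rule bandit_family.intro)
    show "finite (set_pmf G)" "finite \<Theta>" by (fact hb he)+
    show "prob_space (F \<theta> x)" "sets (F \<theta> x) = sets borel" if "\<theta> \<in> \<Theta>" "x \<in> set_pmf G" for \<theta> x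
      using model that by auto
    show "KL_finite (F \<theta> x) (F \<theta>' x)" "0 < KLnum (F \<theta> x) (F \<theta>' x)"
      if "\<theta> \<in> \<Theta>" "\<theta>' \<in> \<Theta>" "\<theta> \<noteq> \<theta>'" "x \<in> set_pmf G" for \<theta> \<theta>' x
      using hc that by auto
    show "xst a b \<in> set_pmf G" for a b using xst_max by blast
  qed
  have main: "\<exists>c. \<forall>T\<ge>1. ETinf F G policy C T \<le> level T / \<kappa> + c"
    if hC: "fst C \<in> \<Theta>" "snd C \<in> \<Theta>" "j \<in> {1, 2}" "par C j < par C (3 - j)" and \<kappa>: "0 < \<kappa>"
      "\<And>\<theta>. \<theta> \<in> \<Theta> \<Longrightarrow> par C (3 - j) < \<theta> \<Longrightarrow>
        \<kappa> < KLnum (F (par C j) (xst (par C j) (par C (3 - j)))) (F \<theta> (xst (par C j) (par C (3 - j))))"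
    for C j \<kappa>
  proof -
    interpret bandit_config \<Theta> F G xst C
      using hC by unfold_locales
    show ?thesis
    proof (rule ETinf_le[OF hC(3,4) _ \<kappa>])
      show "mean F (par C j) x < mean F (par C (3 - j)) x" if "x \<in> set_pmf G" for x
        using hd that par_in hC(4) by blast
    qed
  qed
  have inferior: "\<exists>j\<in>{1, 2}. par C j < par C (3 - j)" if "fst C \<noteq> snd C" for C
  proof (cases "fst C < snd C")
    case True
    then show ?thesis by (intro bexI[of _ 1]) (auto simp: par_def)
  next
    case False
    with that show ?thesis by (intro bexI[of _ 2]) (auto simp: par_def)
  qed
  have "(\<lambda>t. ETinf F G policy C t) \<in> o(\<lambda>t. real t powr \<alpha>)" if hC: "C \<in> \<Theta> \<times> \<Theta>" and \<alpha>: "0 < \<alpha>" for C \<alpha>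
  proof -
    interpret bandit_config \<Theta> F G xst C
      using hC by unfold_locales auto
    show ?thesis
    proof (cases "fst C = snd C")
      case True
      then show ?thesis by (simp add: ETinf_eq_0)
    next
      case False
      then obtain j where j: "j \<in> {1, 2}" "par C j < par C (3 - j)"
        using inferior by blast
      let ?x = "xst (par C j) (par C (3 - j))"
      let ?f = "\<lambda>\<theta>. KLnum (F (par C j) ?x) (F \<theta> ?x)"
      \<comment> \<open>The element 1 keeps the set nonempty when no parameter lies above the
        superior one; halving the minimum makes the inequalities strict. Any positive rate suffices
        for uniform goodness.\<close>
      let ?S = "insert 1 (?f ` {\<theta>\<in>\<Theta>. par C (3 - j) < \<theta>})"
      define \<kappa> where "\<kappa> = Min ?S / 2"
      have fin: "finite ?S" using he by simp
      have "0 < ?f \<theta>" if "\<theta> \<in> \<Theta>" "par C (3 - j) < \<theta>" for \<theta>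
        using that j(2) xst_max[of "par C j" "par C (3 - j)"] par_in[of j] by (intro KL_pos) auto
      then have "0 < Min ?S"
        using fin by (subst Min_gr_iff) auto
      moreover have "Min ?S \<le> ?f \<theta>" if "\<theta> \<in> \<Theta>" "par C (3 - j) < \<theta>" for \<theta>
        using fin that by (intro Min_le) auto
      ultimately have \<kappa>: "0 < \<kappa>" "\<And>\<theta>. \<theta> \<in> \<Theta> \<Longrightarrow> par C (3 - j) < \<theta> \<Longrightarrow> \<kappa> < ?f \<theta>"
        unfolding \<kappa>_def by fastforce+
      obtain c where c: "\<And>T. 1 \<le> T \<Longrightarrow> ETinf F G policy C T \<le> level T / \<kappa> + c"
        using main[OF C j \<kappa>] by blast
      have "(\<lambda>t. ETinf F G policy C t) \<in> O(\<lambda>t. level t / \<kappa> + c)"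
      proof (rule bigoI[where c=1])
        show "\<forall>\<^sub>F t in at_top. norm (ETinf F G policy C t) \<le> 1 * norm (level t / \<kappa> + c)"
          using eventually_ge_at_top[of 1]
        proof eventually_elim
          case (elim t)
          then show ?case using c[of t] ETinf_nonneg[of t] by simp
        qed
      qed
      moreover have "(\<lambda>t. level t / \<kappa> + c) \<in> o(\<lambda>t. real t powr \<alpha>)"
        unfolding level_def using \<kappa>(1) \<alpha> by real_asymp
      ultimately show ?thesis
        by (rule landau_o.big_small_trans)
    qed
  qed
  then have "uniformly_good F G \<Theta> policy"
    unfolding uniformly_good_def by blast
  moreover have "limsup (\<lambda>t. ereal (ETinf F G policy (\<theta>1, \<theta>2) t / ln (real t))) \<le> inverse (Kc F G \<Theta> (\<theta>1, \<theta>2))"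
    if \<theta>: "\<theta>1 \<in> \<Theta>" "\<theta>2 \<in> \<Theta>" "\<theta>1 \<noteq> \<theta>2" for \<theta>1 \<theta>2
  proof -
    let ?C = "(\<theta>1, \<theta>2)"
    obtain j where j: "j \<in> {1, 2}" "par ?C j < par ?C (3 - j)"
      using inferior[of ?C] \<theta>(3) by (metis fst_conv snd_conv)
    let ?a = "par ?C j" and ?b = "par ?C (3 - j)"
    have ab: "?a \<in> \<Theta>" "?b \<in> \<Theta>" using \<theta> by (auto simp: par_def)
    have Kc: "Kc F G \<Theta> ?C = (INF \<theta>\<in>{\<theta>\<in>\<Theta>. ?b < \<theta>}. SUP x\<in>set_pmf G. ereal (KLnum (F ?a x) (F \<theta> x)))"
      using j \<theta> by (auto simp: Kc_def par_def)
    show ?thesis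
    proof (rule limsup_le_inverse)
      show "0 \<le> Kc F G \<Theta> ?C"
        unfolding Kc
      proof (rule INF_greatest)
        fix \<theta> assume "\<theta> \<in> {\<theta>\<in>\<Theta>. ?b < \<theta>}"
        then have "0 < KLnum (F ?a (xst ?a ?b)) (F \<theta> (xst ?a ?b))"
          using ab j(2) xst_max by (intro KL_pos) auto
        then have "0 \<le> ereal (KLnum (F ?a (xst ?a ?b)) (F \<theta> (xst ?a ?b)))" by simp
        also have "\<dots> \<le> (SUP x\<in>set_pmf G. ereal (KLnum (F ?a x) (F \<theta> x)))"
          using xst_max by (intro SUP_upper) auto
        finally show "0 \<le> (SUP x\<in>set_pmf G. ereal (KLnum (F ?a x) (F \<theta> x)))" .
      qed
      fix \<kappa> :: real assume \<kappa>: "0 < \<kappa>" "ereal \<kappa> < Kc F G \<Theta> ?C"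
      \<comment> \<open>Hypothesis (f) enters here: it turns the infimum of suprema into a supremum
        over covariates, which \<open>xst\<close> attains, so every rate below K is available
        against all competitors at that one covariate.\<close>
      have "Kc F G \<Theta> ?C = (SUP x\<in>set_pmf G. g ?a ?b x)"
        unfolding Kc g_def using hf ab j(2) by blast
      also have "\<dots> \<le> g ?a ?b (xst ?a ?b)"
        using xst_max by (intro SUP_least) auto
      finally have *: "ereal \<kappa> < g ?a ?b (xst ?a ?b)"
        using \<kappa>(2) by (rule less_le_trans[rotated])
      have "\<kappa> < KLnum (F ?a (xst ?a ?b)) (F \<theta> (xst ?a ?b))" if "\<theta> \<in> \<Theta>" "?b < \<theta>" for \<theta>
      proof -
        have "g ?a ?b (xst ?a ?b) \<le> ereal (KLnum (F ?a (xst ?a ?b)) (F \<theta> (xst ?a ?b)))"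
          unfolding g_def using that by (intro INF_lower) auto
        with * have "ereal \<kappa> < ereal (KLnum (F ?a (xst ?a ?b)) (F \<theta> (xst ?a ?b)))"
          by (rule less_le_trans)
        then show ?thesis by simp
      qed
      from main[OF _ _ j \<kappa>(1) this] \<theta>
      show "\<exists>c. \<forall>T\<ge>1. ETinf F G policy ?C T \<le> (ln (real T) + 2 * ln (1 + ln (real T))) / \<kappa> + c"
        unfolding level_def by simp
    qed
  qed
  ultimately show ?thesis
    using alloc_rule_policy by blast
qed

end
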